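(* Let $\nabla$ be a left-invariant torsion-free Koszul connection on $T\mathcal A^+(n,\mathbb R)$. Then $\nabla$ is biinvariant if and only if there exists an $a\in\mathbb R$ such that $$\nabla_xy=\frac12[x,y]+a\left(x_0y_0e_0+\frac12x_0y_v+\frac12y_0x_v\right)=\frac{a+1}{2}x_0y+\frac{a-1}{2}y_0x$$ for all $x,y\in\mathfrak a^+$. For an arbitrary $a\in\mathbb R$, the formula defines a $\mathcal P$-complete biinvariant connection.
   Context: $\mathcal A^+(n,\mathbb R)=\left\{\begin{bmatrix} aI_n& b\\0&1\end{bmatrix}\mid a\in\mathbb R,\ a>0,\ b\in\mathbb R^n\right\}$, a Lie group of dimension $n+1$ ($n\ge1$) with Lie algebra $\mathfrak a^+$. Put $e_0=\begin{bmatrix}I_n&0\\0&0\end{bmatrix}$ and let $e_j$ ($j=1,\dots,n$) be the $(n+1)\times(n+1)$ matrix whose only nonzero entry is a $1$ in row $j$, column $n+1$; $V=\operatorname{span}\{e_1,\dots,e_n\}$. Then $\mathfrak a^+=\langle e_0\rangle\oplus V$ and each $x\in\mathfrak a^+$ is written $x=x_0e_0+x_v$ with $x_0\in\mathbb R$, $x_v\in V$; the bracket is $[x,y]=x_0y_v-y_0x_v=x_0y-y_0x$. Elements of $\mathfrak a^+$ are identified with left invariant vector fields. A Koszul connection (linear connection on the tangent bundle) is biinvariant if it is both left and right invariant. For a Koszul connection $\nabla$ on a manifold $M$ and $v\in TM$ let $\gamma_v:I_v\to M$ be the maximal $\nabla$-geodesic with $\dot\gamma_v(0)=v$, $\mathbb{C}I_v=\{t+is:t\in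 I_v,\ s\in\mathbb R\}$ and $\Omega_v:\mathbb{C}I_v\to TM$, $\Omega_v(t+is)=s\dot\gamma_v(t)$. A polarization on an even-dimensional smooth manifold $X$ is a smooth complex subbundle $P\subset\mathbb{C}TX$ closed under Lie brackets of local smooth sections with $\operatorname{rank}_{\mathbb C}P=\frac12\dim X$. An ac-polarization on $TM$ is a polarization $P$ on the manifold $TM$ with $(\Omega_v)_*(T^{1,0}(\mathbb{C}I_v))\subset P$ for all $v\in TM$. $\nabla$ is $\mathcal P$-complete if an ac-polarization exists on $TM$. *)

theory Defs
  imports "HOL-Analysis.Analysis"
begin

text \<open>
  The group \<open>A\<^sup>+(n, \<real>)\<close> is diffeomorphic to a half-space, by the global chart that reads off \<open>a\<close> and
  \<open>b\<close> from a matrix. Manifolds are therefore represented as open subsets \<open>M\<close> of a Euclidean space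
  \<open>'a\<close>, with tangent bundle \<open>M \<times> UNIV \<subseteq> 'a \<times> 'a\<close>, again such a manifold. Vector fields are functions
  \<open>'a \<Rightarrow> 'a\<close> of which only the values on \<open>M\<close> matter.
\<close>

section \<open>Vector fields and connections on open subsets of a Euclidean space\<close>

primrec Ck_on :: "nat \<Rightarrow> 'a set \<Rightarrow> ('a::real_normed_vector \<Rightarrow> 'b::real_normed_vector) \<Rightarrow> bool" where
  "Ck_on 0 S f \<longleftrightarrow> continuous_on S f"
| "Ck_on (Suc k) S f \<longleftrightarrow> (\<forall>x\<in>S. f differentiable at x) \<and>
     (\<forall>v. Ck_on k S (\<lambda>x. frechet_derivative f (at x) v))"

text \<open>Only used for open \<open>S\<close> in finite-dimensional spaces, where it means \<open>C\<^sup>\<infinity>\<close>.\<close>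

definition smooth_on :: "'a set \<Rightarrow> ('a::euclidean_space \<Rightarrow> 'b::euclidean_space) \<Rightarrow> bool" where
  "smooth_on S f \<longleftrightarrow> (\<forall>k. Ck_on k S f)"

definition lie_bracket :: "('a::euclidean_space \<Rightarrow> 'a) \<Rightarrow> ('a \<Rightarrow> 'a) \<Rightarrow> 'a \<Rightarrow> 'a" where
  "lie_bracket X Y p = frechet_derivative Y (at p) (X p) - frechet_derivative X (at p) (Y p)"

type_synonym 'a connection = "('a \<Rightarrow> 'a) \<Rightarrow> ('a \<Rightarrow> 'a) \<Rightarrow> 'a \<Rightarrow> 'a"

text \<open>
  Taking \<open>f\<close> to be the indicator function of \<open>M\<close> in the conditions below shows that \<open>D X Y\<close> on \<open>M\<close>
  depends only on the restrictions of \<open>X\<close> and \<open>Y\<close> to \<open>M\<close>.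
\<close>

definition koszul_connection :: "'a::euclidean_space set \<Rightarrow> 'a connection \<Rightarrow> bool" where
  "koszul_connection M D \<longleftrightarrow>
     (\<forall>X Y. smooth_on M X \<longrightarrow> smooth_on M Y \<longrightarrow> smooth_on M (D X Y)) \<and>
     (\<forall>X X' Y. smooth_on M X \<longrightarrow> smooth_on M X' \<longrightarrow> smooth_on M Y \<longrightarrow>
        (\<forall>p\<in>M. D (\<lambda>q. X q + X' q) Y p = D X Y p + D X' Y p)) \<and>
     (\<forall>(f :: 'a \<Rightarrow> real) X Y. smooth_on M f \<longrightarrow> smooth_on M X \<longrightarrow> smooth_on M Y \<longrightarrow>
        (\<forall>p\<in>M. D (\<lambda>q. f q *\<^sub>R X q) Y p = f p *\<^sub>R D X Y p)) \<and>
     (\<forall>X Y Y'. smooth_on M X \<longrightarrow> smooth_on M Y \<longrightarrow> smooth_on M Y' \<longrightarrow>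
        (\<forall>p\<in>M. D X (\<lambda>q. Y q + Y' q) p = D X Y p + D X Y' p)) \<and>
     (\<forall>(f :: 'a \<Rightarrow> real) X Y. smooth_on M f \<longrightarrow> smooth_on M X \<longrightarrow> smooth_on M Y \<longrightarrow>
        (\<forall>p\<in>M. D X (\<lambda>q. f q *\<^sub>R Y q) p =
           f p *\<^sub>R D X Y p + frechet_derivative f (at p) (X p) *\<^sub>R Y p))"

definition torsion_free :: "'a::euclidean_space set \<Rightarrow> 'a connection \<Rightarrow> bool" where
  "torsion_free M D \<longleftrightarrow>
     (\<forall>X Y. smooth_on M X \<longrightarrow> smooth_on M Y \<longrightarrow>
        (\<forall>p\<in>M. D X Y p - D Y X p = lie_bracket X Y p))"

definition pushforward :: "'a set \<Rightarrow> ('a \<Rightarrow> 'a) \<Rightarrow> ('a \<Rightarrow> 'a) \<Rightarrow> 'a::euclidean_space \<Rightarrow> 'a" where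
  "pushforward M \<phi> X p = (let q = the_inv_into M \<phi> p in frechet_derivative \<phi> (at q) (X q))"

definition invariant_under :: "'a::euclidean_space set \<Rightarrow> ('a \<Rightarrow> 'a) \<Rightarrow> 'a connection \<Rightarrow> bool" where
  "invariant_under M \<phi> D \<longleftrightarrow>
     (\<forall>X Y. smooth_on M X \<longrightarrow> smooth_on M Y \<longrightarrow>
        (\<forall>p\<in>M. D (pushforward M \<phi> X) (pushforward M \<phi> Y) p = pushforward M \<phi> (D X Y) p))"

section \<open>Geodesics\<close>

text \<open>The Christoffel symbols are the values of the connection on the coordinate fields.\<close>

definition christoffel :: "'a connection \<Rightarrow> 'a \<Rightarrow> 'a \<Rightarrow> 'a \<Rightarrow> 'a" where
  "christoffel D p u v = D (\<lambda>_. u) (\<lambda>_. v) p"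

definition velocity :: "(real \<Rightarrow> 'a) \<Rightarrow> real \<Rightarrow> 'a::euclidean_space" where
  "velocity \<gamma> t = vector_derivative \<gamma> (at t)"

definition geodesic :: "'a::euclidean_space set \<Rightarrow> 'a connection \<Rightarrow> real set \<Rightarrow> (real \<Rightarrow> 'a) \<Rightarrow> bool" where
  "geodesic M D I \<gamma> \<longleftrightarrow> open I \<and> is_interval I \<and> smooth_on I \<gamma> \<and> \<gamma> ` I \<subseteq> M \<and>
     (\<forall>t\<in>I. velocity (velocity \<gamma>) t + christoffel D (\<gamma> t) (velocity \<gamma> t) (velocity \<gamma> t) = 0)"

definition geodesic_from ::
  "'a::euclidean_space set \<Rightarrow> 'a connection \<Rightarrow> 'a \<times> 'a \<Rightarrow> real set \<Rightarrow> (real \<Rightarrow> 'a) \<Rightarrow> bool" where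
  "geodesic_from M D v I \<gamma> \<longleftrightarrow> geodesic M D I \<gamma> \<and> 0 \<in> I \<and> (\<gamma> 0, velocity \<gamma> 0) = v"

definition maximal_geodesic ::
  "'a::euclidean_space set \<Rightarrow> 'a connection \<Rightarrow> 'a \<times> 'a \<Rightarrow> real set \<Rightarrow> (real \<Rightarrow> 'a) \<Rightarrow> bool" where
  "maximal_geodesic M D v I \<gamma> \<longleftrightarrow> geodesic_from M D v I \<gamma> \<and>
     (\<forall>J \<delta>. geodesic_from M D v J \<delta> \<longrightarrow> J \<subseteq> I \<and> (\<forall>t\<in>J. \<delta> t = \<gamma> t))"

section \<open>Polarizations\<close>

text \<open>
  The pair \<open>(u, v)\<close> stands for the element \<open>u + \<i>v\<close> of the complexification of \<open>'b\<close>.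
\<close>

definition cscale :: "complex \<Rightarrow> 'b \<times> 'b \<Rightarrow> 'b \<times> 'b::real_vector" where
  "cscale c z = (Re c *\<^sub>R fst z - Im c *\<^sub>R snd z, Re c *\<^sub>R snd z + Im c *\<^sub>R fst z)"

global_interpretation cplx: vector_space "cscale :: complex \<Rightarrow> 'b \<times> 'b \<Rightarrow> 'b \<times> 'b::real_vector"
  by unfold_locales (auto simp: cscale_def prod_eq_iff algebra_simps)

definition cmap :: "('a \<Rightarrow> 'b) \<Rightarrow> 'a \<times> 'a \<Rightarrow> 'b \<times> 'b" where
  "cmap L z = (L (fst z), L (snd z))"

text \<open>The complex bilinear extension of the Lie bracket.\<close>

definition clie_bracket ::
  "('b::euclidean_space \<Rightarrow> 'b \<times> 'b) \<Rightarrow> ('b \<Rightarrow> 'b \<times> 'b) \<Rightarrow> 'b \<Rightarrow> 'b \<times> 'b" where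
  "clie_bracket Z W p =
     (lie_bracket (fst \<circ> Z) (fst \<circ> W) p - lie_bracket (snd \<circ> Z) (snd \<circ> W) p,
      lie_bracket (fst \<circ> Z) (snd \<circ> W) p + lie_bracket (snd \<circ> Z) (fst \<circ> W) p)"

text \<open>A family of fibres \<open>P\<close> is a smooth complex subbundle of rank \<open>k\<close> if it has local smooth frames.\<close>

definition complex_subbundle ::
  "'b::euclidean_space set \<Rightarrow> nat \<Rightarrow> ('b \<Rightarrow> ('b \<times> 'b) set) \<Rightarrow> bool" where
  "complex_subbundle X k P \<longleftrightarrow>
     (\<forall>p\<in>X. \<exists>W s. open W \<and> p \<in> W \<and> W \<subseteq> X \<and> (\<forall>i<k. smooth_on W (s i)) \<and>
        (\<forall>q\<in>W. inj_on (\<lambda>i. s i q) {..<k} \<and>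
           cplx.independent ((\<lambda>i. s i q) ` {..<k}) \<and>
           cplx.span ((\<lambda>i. s i q) ` {..<k}) = P q))"

definition smooth_section ::
  "'b::euclidean_space set \<Rightarrow> ('b \<Rightarrow> ('b \<times> 'b) set) \<Rightarrow> ('b \<Rightarrow> 'b \<times> 'b) \<Rightarrow> bool" where
  "smooth_section W P Z \<longleftrightarrow> smooth_on W Z \<and> (\<forall>q\<in>W. Z q \<in> P q)"

definition involutive :: "'b::euclidean_space set \<Rightarrow> ('b \<Rightarrow> ('b \<times> 'b) set) \<Rightarrow> bool" where
  "involutive X P \<longleftrightarrow>
     (\<forall>W Z Z'. open W \<longrightarrow> W \<subseteq> X \<longrightarrow> smooth_section W P Z \<longrightarrow> smooth_section W P Z' \<longrightarrow>
        (\<forall>q\<in>W. clie_bracket Z Z' q \<in> P q))"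

definition polarization :: "'b::euclidean_space set \<Rightarrow> ('b \<Rightarrow> ('b \<times> 'b) set) \<Rightarrow> bool" where
  "polarization X P \<longleftrightarrow>
     even DIM('b) \<and> complex_subbundle X (DIM('b) div 2) P \<and> involutive X P"

definition tangent_bundle :: "'a::euclidean_space set \<Rightarrow> ('a \<times> 'a) set" where
  "tangent_bundle M = M \<times> UNIV"

definition complex_strip :: "real set \<Rightarrow> complex set" where
  "complex_strip I = {z. Re z \<in> I}"

definition Omega :: "(real \<Rightarrow> 'a) \<Rightarrow> complex \<Rightarrow> 'a \<times> 'a::euclidean_space" where
  "Omega \<gamma> z = (\<gamma> (Re z), Im z *\<^sub>R velocity \<gamma> (Re z))"

text \<open>
  The fibre, at any point of an open subset of the complex plane, of the \<open>(1, 0)\<close>-tangent bundle: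
  the \<open>\<i>\<close>-eigenspace of the complexification of the complex structure, multiplication by \<open>\<i>\<close>.
\<close>

definition T10 :: "(complex \<times> complex) set" where
  "T10 = {w. cmap (\<lambda>u. \<i> * u) w = cscale \<i> w}"

definition ac_polarization ::
  "'a::euclidean_space set \<Rightarrow> 'a connection \<Rightarrow> ('a \<times> 'a \<Rightarrow> (('a \<times> 'a) \<times> ('a \<times> 'a)) set) \<Rightarrow> bool" where
  "ac_polarization M D P \<longleftrightarrow> polarization (tangent_bundle M) P \<and>
     (\<forall>v\<in>tangent_bundle M. \<forall>I \<gamma>. maximal_geodesic M D v I \<gamma> \<longrightarrow>
        (\<forall>z\<in>complex_strip I.
           cmap (frechet_derivative (Omega \<gamma>) (at z)) ` T10 \<subseteq> P (Omega \<gamma> z)))"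

definition P_complete :: "'a::euclidean_space set \<Rightarrow> 'a connection \<Rightarrow> bool" where
  "P_complete M D \<longleftrightarrow> (\<exists>P. ac_polarization M D P)"

section \<open>The group and its Lie algebra\<close>

text \<open>
  Rows and columns of \<open>(n+1) \<times> (n+1)\<close> matrices are indexed by \<open>'n option\<close>, where \<open>n\<close> is the
  cardinality of \<open>'n\<close> and \<open>None\<close> is the last index.
\<close>

type_synonym 'n amat = "real ^ 'n option ^ 'n option"
type_synonym 'n acoord = "real \<times> (real ^ 'n)"

definition aff_matrix :: "'n::finite acoord \<Rightarrow> 'n amat" where
  "aff_matrix p = (\<chi> i j. case i of
       Some r \<Rightarrow> (case j of Some c \<Rightarrow> (if r = c then fst p else 0) | None \<Rightarrow> snd p $ r)
     | None \<Rightarrow> (case j of Some c \<Rightarrow> 0 | None \<Rightarrow> 1))"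

definition half_space :: "'n::finite acoord set" where
  "half_space = {p. fst p > 0}"

definition aff_group :: "'n::finite amat set" where
  "aff_group = aff_matrix ` half_space"

definition aff_chart :: "'n::finite amat \<Rightarrow> 'n acoord" where
  "aff_chart = the_inv_into half_space aff_matrix"

definition left_trans :: "'n::finite amat \<Rightarrow> 'n acoord \<Rightarrow> 'n acoord" where
  "left_trans g p = aff_chart (g ** aff_matrix p)"

definition right_trans :: "'n::finite amat \<Rightarrow> 'n acoord \<Rightarrow> 'n acoord" where
  "right_trans g p = aff_chart (aff_matrix p ** g)"

definition left_invariant :: "'n::finite acoord connection \<Rightarrow> bool" where
  "left_invariant D \<longleftrightarrow> (\<forall>g\<in>aff_group. invariant_under half_space (left_trans g) D)"

definition right_invariant :: "'n::finite acoord connection \<Rightarrow> bool" where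
  "right_invariant D \<longleftrightarrow> (\<forall>g\<in>aff_group. invariant_under half_space (right_trans g) D)"

definition biinvariant :: "'n::finite acoord connection \<Rightarrow> bool" where
  "biinvariant D \<longleftrightarrow> left_invariant D \<and> right_invariant D"

definition e0 :: "'n::finite amat" where
  "e0 = (\<chi> i j. if i = j \<and> i \<noteq> None then 1 else 0)"

definition e_vec :: "'n \<Rightarrow> 'n::finite amat" where
  "e_vec k = (\<chi> i j. if i = Some k \<and> j = None then 1 else 0)"

definition V_sub :: "'n::finite amat set" where
  "V_sub = span (range e_vec)"

definition mat_bracket :: "'n::finite amat \<Rightarrow> 'n amat \<Rightarrow> 'n amat" where
  "mat_bracket x y = x ** y - y ** x"

text \<open>
  The left invariant vector field \<open>g \<mapsto> g x\<close> defined by an element \<open>x\<close> of the Lie algebra, expressed in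
  the chart.
\<close>

definition left_field :: "'n::finite amat \<Rightarrow> 'n acoord \<Rightarrow> 'n acoord" where
  "left_field x p = (THE \<xi>. frechet_derivative aff_matrix (at p) \<xi> = aff_matrix p ** x)"

text \<open>
  The formula is required of all elements \<open>x = x\<^sub>0 e\<^sub>0 + x\<^sub>v\<close> and \<open>y = y\<^sub>0 e\<^sub>0 + y\<^sub>v\<close> of the Lie algebra.
\<close>

definition form1 :: "real \<Rightarrow> real \<Rightarrow> 'n::finite amat \<Rightarrow> real \<Rightarrow> 'n amat \<Rightarrow> 'n amat" where
  "form1 a x0 xv y0 yv =
     (1/2) *\<^sub>R mat_bracket (x0 *\<^sub>R e0 + xv) (y0 *\<^sub>R e0 + yv) +
     a *\<^sub>R ((x0 * y0) *\<^sub>R e0 + (1/2 * x0) *\<^sub>R yv + (1/2 * y0) *\<^sub>R xv)"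

definition form2 :: "real \<Rightarrow> real \<Rightarrow> 'n::finite amat \<Rightarrow> real \<Rightarrow> 'n amat \<Rightarrow> 'n amat" where
  "form2 a x0 xv y0 yv =
     ((a + 1) / 2 * x0) *\<^sub>R (y0 *\<^sub>R e0 + yv) + ((a - 1) / 2 * y0) *\<^sub>R (x0 *\<^sub>R e0 + xv)"

definition satisfies_formula :: "real \<Rightarrow> 'n::finite acoord connection \<Rightarrow> bool" where
  "satisfies_formula a D \<longleftrightarrow>
     (\<forall>x0 y0. \<forall>xv\<in>V_sub. \<forall>yv\<in>V_sub. \<forall>p\<in>half_space.
        D (left_field (x0 *\<^sub>R e0 + xv)) (left_field (y0 *\<^sub>R e0 + yv)) p =
        left_field (form1 a x0 xv y0 yv) p)"

section \<open>Consistency of the encoding of the group with the usual formulas\<close>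

lemma aff_matrix_nth [simp]:
  "aff_matrix p $ Some r $ Some c = (if r = c then fst p else 0)"
  "aff_matrix p $ Some r $ None = snd p $ r"
  "aff_matrix p $ None $ Some c = 0"
  "aff_matrix p $ None $ None = 1"
  by (auto simp: aff_matrix_def)

lemma sum_UNIV_option:
  "(\<Sum>k\<in>(UNIV :: 'n::finite option set). f k) = f None + (\<Sum>k\<in>UNIV. f (Some k))" for f :: "_ \<Rightarrow> real"
  by (simp add: UNIV_option_conv sum.reindex)

lemma inj_aff_matrix: "inj aff_matrix"
  by (rule injI) (metis aff_matrix_nth(1) aff_matrix_nth(2) prod_eq_iff vec_eq_iff)

lemma aff_matrix_mult:
  "aff_matrix p ** aff_matrix q = aff_matrix (fst p * fst q, snd p + fst p *\<^sub>R snd q)"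
  apply (simp add: vec_eq_iff matrix_matrix_mult_def sum_UNIV_option)
  apply (intro allI)
  subgoal for i j
    by (cases i; cases j) (auto simp: if_distrib[of "\<lambda>x. x * _"] cong: if_cong)
  done

lemma aff_chart_aff_matrix: "p \<in> half_space \<Longrightarrow> aff_chart (aff_matrix p) = p"
  unfolding aff_chart_def using inj_aff_matrix by (meson inj_on_subset subset_UNIV the_inv_into_f_f)

lemma left_right_trans_eq:
  assumes "p \<in> half_space" "q \<in> half_space"
  shows "left_trans (aff_matrix p) q = (fst p * fst q, snd p + fst p *\<^sub>R snd q)"
    and "right_trans (aff_matrix q) p = (fst p * fst q, snd p + fst p *\<^sub>R snd q)"
proof -
  have "(fst p * fst q, snd p + fst p *\<^sub>R snd q) \<in> half_space"
    using assms by (simp add: half_space_def)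
  then show "left_trans (aff_matrix p) q = (fst p * fst q, snd p + fst p *\<^sub>R snd q)"
    "right_trans (aff_matrix q) p = (fst p * fst q, snd p + fst p *\<^sub>R snd q)"
    by (simp_all add: left_trans_def right_trans_def aff_matrix_mult aff_chart_aff_matrix)
qed

definition vec_part :: "real ^ 'n::finite \<Rightarrow> 'n amat" where
  "vec_part b = (\<Sum>k\<in>UNIV. (b $ k) *\<^sub>R e_vec k)"

lemma vec_part_nth:
  "vec_part b $ i $ j = (case i of Some r \<Rightarrow> if j = None then b $ r else 0 | None \<Rightarrow> 0)"
  by (cases i; cases j)
    (auto simp: vec_part_def e_vec_def if_distrib[of "\<lambda>x. _ * x"] cong: if_cong)

lemma V_sub_eq: "(V_sub :: 'n::finite amat set) = range vec_part"
proof (intro equalityI subsetI)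
  fix x :: "'n amat"
  assume "x \<in> V_sub"
  then have "\<exists>b. x = vec_part b"
    unfolding V_sub_def
  proof (induction rule: span_induct_alt)
    case base
    then show ?case by (intro exI[of _ 0]) (simp add: vec_part_def)
  next
    case (step c x y)
    then obtain k b where "x = e_vec k" "y = vec_part b" by auto
    then have "c *\<^sub>R x + y = vec_part (c *\<^sub>R axis k 1 + b)"
      by (auto simp: vec_eq_iff vec_part_nth e_vec_def axis_def split: option.splits)
    then show ?case by blast
  qed
  then show "x \<in> range vec_part" by blast
next
  fix x :: "'n amat"
  assume "x \<in> range vec_part"
  then show "x \<in> V_sub"
    unfolding V_sub_def vec_part_def by (auto intro!: span_sum span_scale[OF span_base])
qed

lemma mat_bracket_eq:
  assumes "xv \<in> V_sub" "yv \<in> V_sub"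
  shows "mat_bracket (x0 *\<^sub>R e0 + xv) (y0 *\<^sub>R e0 + yv) = x0 *\<^sub>R yv - y0 *\<^sub>R xv"
proof -
  obtain b c where bc: "xv = vec_part b" "yv = vec_part c"
    using assms by (auto simp: V_sub_eq)
  show ?thesis
    unfolding bc
    apply (simp add: mat_bracket_def vec_eq_iff matrix_matrix_mult_def sum_UNIV_option
        vec_part_nth e0_def)
    apply (intro allI)
    subgoal for i j
      by (cases i; cases j)
        (auto simp: if_distrib[of "\<lambda>x. x * _"] if_distrib[of "\<lambda>x. _ * x"] cong: if_cong)
    done
qed

lemma aff_matrix_has_derivative:
  "(aff_matrix has_derivative (\<lambda>\<xi>. fst \<xi> *\<^sub>R e0 + vec_part (snd \<xi>))) (at p)"
proof -
  have eq: "aff_matrix = (\<lambda>p. (fst p *\<^sub>R e0 + vec_part (snd p)) + aff_matrix (0, 0))"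
    apply (rule ext)
    apply (simp add: vec_eq_iff vec_part_nth e0_def)
    apply (intro allI)
    subgoal for p i j by (cases i; cases j) auto
    done
  show ?thesis
    apply (subst (1) eq)
    unfolding vec_part_def
    by (auto intro!: derivative_eq_intros bounded_linear.has_derivative[OF bounded_linear_vec_nth])
qed

lemma left_field_eq:
  "left_field (x0 *\<^sub>R e0 + vec_part b) p = (fst p * x0, fst p *\<^sub>R b)"
proof -
  have m: "aff_matrix p ** (x0 *\<^sub>R e0 + vec_part b) = (fst p * x0) *\<^sub>R e0 + vec_part (fst p *\<^sub>R b)"
    apply (simp add: vec_eq_iff matrix_matrix_mult_def sum_UNIV_option vec_part_nth e0_def)
    apply (intro allI)
    subgoal for i j
      by (cases i; cases j)
        (auto simp: if_distrib[of "\<lambda>x. x * _"] if_distrib[of "\<lambda>x. _ * x"] cong: if_cong)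
    done
  have u: "\<xi> = (c, d)"
    if "fst \<xi> *\<^sub>R e0 + vec_part (snd \<xi>) = c *\<^sub>R e0 + vec_part d" for \<xi> :: "'a acoord" and c d
  proof -
    have "(fst \<xi> *\<^sub>R e0 + vec_part (snd \<xi>)) $ Some i $ j = (c *\<^sub>R e0 + vec_part d) $ Some i $ j" for i j
      using that by simp
    from this[of _ None] this[of "undefined" "Some undefined"] show ?thesis
      by (auto simp: vec_part_nth e0_def prod_eq_iff vec_eq_iff)
  qed
  show ?thesis
    unfolding left_field_def frechet_derivative_at[OF aff_matrix_has_derivative, symmetric] m
    by (rule the_equality) (auto dest: u)
qed

end

theory Submission
  imports Defs "HOL-Complex_Analysis.Cauchy_Integral_Formula"
begin

text \<open>
  In the chart \<open>(r, b)\<close> a connection is the flat connection plus Christoffel symbols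
  (\<open>koszul_eq_christoffel\<close>), and all translations of the group are affine. Invariance therefore means
  that the linear parts of the translations intertwine the Christoffel symbols
  (\<open>invariant_under_affine_iff\<close>). Left invariant Christoffel symbols are \<open>B / r\<close> for a bilinear map \<open>B\<close>, and
  vanishing torsion means that \<open>B\<close> is symmetric. Equivariance under the right translations then leaves
  \<open>B(u, v) = k (u\<^sub>0 v + v\<^sub>0 u)\<close> as the only possibility (\<open>aff_christoffel_if_biinvariant\<close>), and on left
  invariant fields this is the formula of the theorem with \<open>k = (a - 1) / 2\<close>
  (\<open>satisfies_formula_iff_christoffel\<close>). Conversely these Christoffel symbols are visibly equivariant.

  For the polarization, note that the geodesics of this connection are straight lines, on which the
  first coordinate moves as \<open>r (1 + a x t)\<^bsup>1/a\<^esup>\<close> with \<open>x = v\<^sub>0 / r\<close>. They extend to the complex time \<open>-\<i>\<close>, so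
  there is a map \<open>(p, v) \<mapsto> \<gamma>\<^sub>v(-\<i>) = p + psi(x) v\<close> from the tangent bundle to a complex vector space, and it
  maps \<open>\<Omega>\<^sub>v(t + \<i> s)\<close> to \<open>\<gamma>\<^sub>v(t - \<i> s)\<close>. The polarization is the kernel of its complexified differential.
  It contains the images of the \<open>(1, 0)\<close>-vectors, because the composition is antiholomorphic
  (\<open>Omega_tangent_pol\<close>), and it is involutive, because differentials are closed
  (\<open>involutive_kernel_closed_form\<close>). The map need not be a local diffeomorphism; but the components of its
  differential are linearly independent over the complex numbers everywhere, because the equations of
  the kernel can be solved for half of the coordinates (\<open>pol_iff\<close>), and this gives a smooth frame of
  the right rank (\<open>complex_subbundle_pol\<close>).
\<close>

section \<open>Calculus of smooth maps\<close>

lemma Ck_on_SucD: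
  assumes "Ck_on (Suc k) S f"
  shows "x \<in> S \<Longrightarrow> (f has_derivative frechet_derivative f (at x)) (at x)"
    and "Ck_on k S (\<lambda>x. frechet_derivative f (at x) v)"
  using assms by (auto simp: frechet_derivative_works)

lemma linear_eq_sum_Basis:
  fixes L :: "'a::euclidean_space \<Rightarrow> 'b::real_vector"
  assumes "linear L"
  shows "L w = (\<Sum>b\<in>Basis. (w \<bullet> b) *\<^sub>R L b)"
proof -
  have "L w = L (\<Sum>b\<in>Basis. (w \<bullet> b) *\<^sub>R b)"
    by (simp only: euclidean_representation)
  then show ?thesis
    by (simp only: linear_sum[OF assms] linear_scale[OF assms])
qed

lemma Ck_on_cong:
  assumes "open S" and "\<And>x. x \<in> S \<Longrightarrow> f x = g x"
  shows "Ck_on k S f \<longleftrightarrow> Ck_on k S g"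
proof -
  have *: "Ck_on k S g" if "\<And>x. x \<in> S \<Longrightarrow> f x = g x" "Ck_on k S f"
    for f g :: "'a \<Rightarrow> 'b"
    using that
  proof (induction k arbitrary: f g)
    case 0
    then show ?case
      using continuous_on_cong[of S S f g] by simp
  next
    case (Suc k)
    have g: "(g has_derivative frechet_derivative f (at x)) (at x)" if "x \<in> S" for x
      by (rule has_derivative_transform_within_open[OF Ck_on_SucD(1)[OF Suc.prems(2) that]
            \<open>open S\<close> that Suc.prems(1)])
    have eq: "frechet_derivative f (at x) = frechet_derivative g (at x)" if "x \<in> S" for x
      by (rule frechet_derivative_at[OF g[OF that]])
    have "Ck_on k S (\<lambda>x. frechet_derivative g (at x) v)" for v
      by (rule Suc.IH[OF _ Ck_on_SucD(2)[OF Suc.prems(2)]]) (simp add: eq)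
    then show ?case
      using g unfolding Ck_on.simps(2)[of k] differentiable_def by blast
  qed
  show ?thesis
    using *[of f g] *[of g f] assms(2) by auto
qed

text \<open>
  Any pointwise formula for the derivative may replace the Frechet derivative, because \<open>Ck_on\<close> only
  sees the values on the open set.
\<close>
lemma Ck_on_SucI:
  assumes "open S" and "\<And>x. x \<in> S \<Longrightarrow> (f has_derivative f' x) (at x)"
    and "\<And>v. Ck_on k S (\<lambda>x. f' x v)"
  shows "Ck_on (Suc k) S f"
proof -
  have "frechet_derivative f (at x) v = f' x v" if "x \<in> S" for x v
    using frechet_derivative_at[OF assms(2)[OF that]] by simp
  then have "Ck_on k S (\<lambda>x. frechet_derivative f (at x) v)" for v
    using assms(3)[of v]
      Ck_on_cong[OF \<open>open S\<close>, of "\<lambda>x. frechet_derivative f (at x) v" "\<lambda>x. f' x v"] by simp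
  then show ?thesis
    using assms(2) unfolding Ck_on.simps(2)[of k] differentiable_def by blast
qed

lemma Ck_on_SucE: "Ck_on (Suc k) S f \<Longrightarrow> Ck_on k S f"
proof (induction k arbitrary: f)
  case 0
  then show ?case
    by (auto intro!: continuous_at_imp_continuous_on differentiable_imp_continuous_within)
next
  case (Suc k)
  show ?case
    unfolding Ck_on.simps(2)[of k]
    using Ck_on_SucD(1)[OF Suc.prems] Suc.IH[OF Ck_on_SucD(2)[OF Suc.prems]]
    by (auto simp: differentiable_def)
qed

lemma Ck_on_const: "open S \<Longrightarrow> Ck_on k S (\<lambda>_. c)"
  by (induction k arbitrary: c)
    (auto intro!: continuous_intros)

lemma Ck_on_linear:
  assumes "open S" "bounded_linear L" "Ck_on k S f"
  shows "Ck_on k S (\<lambda>x. L (f x))"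
  using assms(3)
proof (induction k arbitrary: f)
  case 0
  then show ?case
    by (simp add: bounded_linear.continuous_on[OF assms(2)])
next
  case (Suc k)
  show ?case
    by (rule Ck_on_SucI[OF \<open>open S\<close>
          bounded_linear.has_derivative[OF assms(2) Ck_on_SucD(1)[OF Suc.prems]]])
      (auto intro: Suc.IH[OF Ck_on_SucD(2)[OF Suc.prems]])
qed

lemma Ck_on_id:
  assumes "open S"
  shows "Ck_on k S (\<lambda>x. x)"
proof (cases k)
  case (Suc n)
  show ?thesis
    unfolding Suc by (rule Ck_on_SucI[OF assms has_derivative_ident Ck_on_const[OF assms]])
qed simp

lemma Ck_on_add:
  assumes "open S" "Ck_on k S f" "Ck_on k S g"
  shows "Ck_on k S (\<lambda>x. f x + g x)"
  using assms(2,3)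
proof (induction k arbitrary: f g)
  case 0
  then show ?case
    by (auto intro!: continuous_intros)
next
  case (Suc k)
  show ?case
    by (rule Ck_on_SucI[OF \<open>open S\<close> has_derivative_add[OF
            Ck_on_SucD(1)[OF Suc.prems(1)] Ck_on_SucD(1)[OF Suc.prems(2)]]])
      (auto intro: Suc.IH[OF Ck_on_SucD(2)[OF Suc.prems(1)] Ck_on_SucD(2)[OF Suc.prems(2)]])
qed

lemma Ck_on_sum:
  assumes "open S" "\<And>i. i \<in> I \<Longrightarrow> Ck_on k S (f i)"
  shows "Ck_on k S (\<lambda>x. \<Sum>i\<in>I. f i x)"
  using assms(2)
  by (induction I rule: infinite_finite_induct) (auto intro!: Ck_on_const Ck_on_add assms(1))

lemma Ck_on_bilinear:
  assumes "open S" "bounded_bilinear B" "Ck_on k S f" "Ck_on k S g"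
  shows "Ck_on k S (\<lambda>x. B (f x) (g x))"
  using assms(3,4)
proof (induction k arbitrary: f g)
  case 0
  then show ?case
    by (simp add: bounded_bilinear.continuous_on[OF assms(2)])
next
  case (Suc k)
  show ?case
    by (rule Ck_on_SucI[OF \<open>open S\<close> bounded_bilinear.FDERIV[OF assms(2)
            Ck_on_SucD(1)[OF Suc.prems(1)] Ck_on_SucD(1)[OF Suc.prems(2)]]])
      (auto intro!: Ck_on_add assms(1) Suc.IH[OF Ck_on_SucE[OF Suc.prems(1)] Ck_on_SucD(2)[OF Suc.prems(2)]]
        Suc.IH[OF Ck_on_SucD(2)[OF Suc.prems(1)] Ck_on_SucE[OF Suc.prems(2)]])
qed

text \<open>
  The derivative of \<open>h\<close> at \<open>f x\<close> is expanded in the standard basis, so that it becomes a finite sum of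
  products of functions to which the induction hypothesis and the closure under products apply.
\<close>
lemma Ck_on_compose:
  fixes f :: "'a::real_normed_vector \<Rightarrow> 'b::euclidean_space"
    and h :: "'b \<Rightarrow> 'c::real_normed_vector"
  assumes "open S" "Ck_on k T h" "Ck_on k S f" "f ` S \<subseteq> T"
  shows "Ck_on k S (\<lambda>x. h (f x))"
  using assms(2,3)
proof (induction k arbitrary: h)
  case 0
  then show ?case
    using assms(4) by (auto intro: continuous_on_compose2)
next
  case (Suc k)
  have der: "((\<lambda>x. h (f x)) has_derivative
      (\<lambda>v. \<Sum>b\<in>Basis. (frechet_derivative f (at x) v \<bullet> b) *\<^sub>R frechet_derivative h (at (f x)) b)) (at x)"
    if "x \<in> S" for x
  proof -
    have h: "(h has_derivative frechet_derivative h (at (f x))) (at (f x))"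
      using Ck_on_SucD(1)[OF Suc.prems(1)] assms(4) that by blast
    have "(\<lambda>v. frechet_derivative h (at (f x)) (frechet_derivative f (at x) v)) =
        (\<lambda>v. \<Sum>b\<in>Basis. (frechet_derivative f (at x) v \<bullet> b) *\<^sub>R frechet_derivative h (at (f x)) b)"
      by (rule ext linear_eq_sum_Basis has_derivative_linear[OF h])+
    then show ?thesis
      using has_derivative_compose[OF Ck_on_SucD(1)[OF Suc.prems(2) that] h] by simp
  qed
  show ?case
  proof (rule Ck_on_SucI[OF \<open>open S\<close> der])
    fix v
    have "Ck_on k S (\<lambda>x. (frechet_derivative f (at x) v \<bullet> b) *\<^sub>R frechet_derivative h (at (f x)) b)" for b
      by (rule Ck_on_bilinear[OF assms(1) bounded_bilinear_scaleR
            Ck_on_linear[OF assms(1) bounded_linear_inner_left Ck_on_SucD(2)[OF Suc.prems(2)]]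
            Suc.IH[OF Ck_on_SucD(2)[OF Suc.prems(1)] Ck_on_SucE[OF Suc.prems(2)]]])
    then show "Ck_on k S (\<lambda>x. \<Sum>b\<in>Basis.
        (frechet_derivative f (at x) v \<bullet> b) *\<^sub>R frechet_derivative h (at (f x)) b)"
      by (intro Ck_on_sum assms(1))
  qed
qed

lemma Ck_on_inverse:
  fixes f :: "'a::real_normed_vector \<Rightarrow> real"
  assumes "open S" "Ck_on k S f" "\<And>x. x \<in> S \<Longrightarrow> f x \<noteq> 0"
  shows "Ck_on k S (\<lambda>x. inverse (f x))"
  using assms(2)
proof (induction k)
  case 0
  then show ?case
    using assms(3) by (auto intro!: continuous_intros)
next
  case (Suc k)
  show ?case
  proof (rule Ck_on_SucI[OF \<open>open S\<close> Deriv.has_derivative_inverse[OF assms(3) Ck_on_SucD(1)[OF Suc.prems]]])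
    fix v
    have *: "Ck_on k S (\<lambda>x. inverse (f x))"
      by (rule Suc.IH[OF Ck_on_SucE[OF Suc.prems]])
    show "Ck_on k S (\<lambda>x. - (inverse (f x) * frechet_derivative f (at x) v * inverse (f x)))"
      by (rule Ck_on_linear[OF assms(1) bounded_linear_minus[OF bounded_linear_ident]
            Ck_on_bilinear[OF assms(1) bounded_bilinear_mult
            Ck_on_bilinear[OF assms(1) bounded_bilinear_mult * Ck_on_SucD(2)[OF Suc.prems]] *]])
  qed
qed

lemma smooth_on_cong:
  "open S \<Longrightarrow> (\<And>x. x \<in> S \<Longrightarrow> f x = g x) \<Longrightarrow> smooth_on S f \<longleftrightarrow> smooth_on S g"
  using Ck_on_cong unfolding smooth_on_def by blast

lemma smooth_on_has_derivative:
  "smooth_on S f \<Longrightarrow> x \<in> S \<Longrightarrow> (f has_derivative frechet_derivative f (at x)) (at x)"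
  using Ck_on_SucD(1) unfolding smooth_on_def by blast

lemma smooth_on_frechet_derivative:
  "smooth_on S f \<Longrightarrow> smooth_on S (\<lambda>x. frechet_derivative f (at x) v)"
  using Ck_on_SucD(2) unfolding smooth_on_def by blast

lemma smooth_on_const: "open S \<Longrightarrow> smooth_on S (\<lambda>_. c)"
  by (simp add: smooth_on_def Ck_on_const)

lemma smooth_on_id: "open S \<Longrightarrow> smooth_on S (\<lambda>x. x)"
  by (simp add: smooth_on_def Ck_on_id)

lemma smooth_on_linear:
  "open S \<Longrightarrow> bounded_linear L \<Longrightarrow> smooth_on S f \<Longrightarrow> smooth_on S (\<lambda>x. L (f x))"
  by (simp add: smooth_on_def Ck_on_linear)

lemma smooth_on_add:
  "open S \<Longrightarrow> smooth_on S f \<Longrightarrow> smooth_on S g \<Longrightarrow> smooth_on S (\<lambda>x. f x + g x)"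
  by (simp add: smooth_on_def Ck_on_add)

lemma smooth_on_sum:
  "open S \<Longrightarrow> (\<And>i. i \<in> I \<Longrightarrow> smooth_on S (f i)) \<Longrightarrow> smooth_on S (\<lambda>x. \<Sum>i\<in>I. f i x)"
  by (simp add: smooth_on_def Ck_on_sum)

lemma smooth_on_bilinear:
  "open S \<Longrightarrow> bounded_bilinear B \<Longrightarrow> smooth_on S f \<Longrightarrow> smooth_on S g \<Longrightarrow>
    smooth_on S (\<lambda>x. B (f x) (g x))"
  by (simp add: smooth_on_def Ck_on_bilinear)

lemma smooth_on_compose:
  "open S \<Longrightarrow> smooth_on T h \<Longrightarrow> smooth_on S f \<Longrightarrow> f ` S \<subseteq> T \<Longrightarrow> smooth_on S (\<lambda>x. h (f x))"
  by (simp add: smooth_on_def Ck_on_compose[where T = T])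

lemma smooth_on_inverse:
  fixes f :: "'a::euclidean_space \<Rightarrow> real"
  shows "open S \<Longrightarrow> smooth_on S f \<Longrightarrow> (\<And>x. x \<in> S \<Longrightarrow> f x \<noteq> 0) \<Longrightarrow> smooth_on S (\<lambda>x. inverse (f x))"
  by (simp add: smooth_on_def Ck_on_inverse)

lemma smooth_on_Pair:
  fixes f :: "'a::euclidean_space \<Rightarrow> 'b::euclidean_space" and g :: "'a \<Rightarrow> 'c::euclidean_space"
  assumes "open S" "smooth_on S f" "smooth_on S g"
  shows "smooth_on S (\<lambda>x. (f x, g x))"
proof -
  have L: "bounded_linear (\<lambda>y::'b. (y, 0::'c))" "bounded_linear (\<lambda>y::'c. (0::'b, y))"
    by (intro bounded_linear_Pair bounded_linear_ident bounded_linear_zero)+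
  have "smooth_on S (\<lambda>x. (f x, 0) + (0, g x))"
    by (rule smooth_on_add[OF assms(1) smooth_on_linear[OF assms(1) L(1) assms(2)]
          smooth_on_linear[OF assms(1) L(2) assms(3)]])
  then show ?thesis
    by simp
qed

lemmas smooth_on_intros =
  smooth_on_const smooth_on_sum smooth_on_linear[OF _ bounded_linear_inner_left]
  smooth_on_bilinear[OF _ bounded_bilinear_scaleR]

text \<open>
  The derivatives of a holomorphic function along the real axis are its complex derivatives, which
  are holomorphic again.
\<close>

lemma smooth_on_holomorphic:
  assumes "h holomorphic_on T" "open T" "range of_real \<subseteq> T"
  shows "smooth_on UNIV (\<lambda>x. h (of_real x))"
proof -
  have "Ck_on k UNIV (\<lambda>x::real. h (of_real x))" for k
    using assms(1)
  proof (induction k arbitrary: h)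
    case 0
    have "continuous_on UNIV (of_real :: real \<Rightarrow> complex)"
      by (intro continuous_intros)
    then show ?case
      using continuous_on_compose2[OF holomorphic_on_imp_continuous_on[OF 0] _ assms(3)] by simp
  next
    case (Suc k)
    have "(h has_field_derivative deriv h (of_real x)) (at (of_real x))" for x :: real
      using assms(3) by (intro holomorphic_derivI[OF Suc.prems assms(2)]) auto
    then have "((\<lambda>x. h (of_real x)) has_derivative (\<lambda>v. deriv h (of_real x) * of_real v)) (at x)" for x :: real
      by (intro has_derivative_compose[OF bounded_linear_imp_has_derivative[OF bounded_linear_of_real]])
        (simp add: has_field_derivative_def)
    moreover have "Ck_on k UNIV (\<lambda>x::real. deriv h (of_real x) * of_real v)" for v :: real
      by (rule Ck_on_bilinear[OF open_UNIV bounded_bilinear_mult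
            Suc.IH[OF holomorphic_deriv[OF Suc.prems assms(2)]] Ck_on_const[OF open_UNIV]])
    ultimately show ?case
      by (intro Ck_on_SucI[OF open_UNIV])
  qed
  then show ?thesis
    by (simp add: smooth_on_def)
qed

lemma bounded_linear_frechet_derivative:
  "smooth_on S f \<Longrightarrow> x \<in> S \<Longrightarrow> bounded_linear (frechet_derivative f (at x))"
  by (rule has_derivative_bounded_linear[OF smooth_on_has_derivative])

lemma smooth_on_derivative_along:
  fixes X :: "'a::euclidean_space \<Rightarrow> 'a"
  assumes "open S" "smooth_on S f" "smooth_on S X"
  shows "smooth_on S (\<lambda>x. frechet_derivative f (at x) (X x))"
proof -
  have eq: "frechet_derivative f (at x) (X x) =
      (\<Sum>b\<in>Basis. (X x \<bullet> b) *\<^sub>R frechet_derivative f (at x) b)" if "x \<in> S" for x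
    by (intro linear_eq_sum_Basis bounded_linear.linear
        bounded_linear_frechet_derivative[OF assms(2) that])
  have sum: "smooth_on S (\<lambda>x. \<Sum>b\<in>Basis. (X x \<bullet> b) *\<^sub>R frechet_derivative f (at x) b)"
    by (intro smooth_on_sum smooth_on_bilinear[OF _ bounded_bilinear_scaleR]
        smooth_on_linear[OF _ bounded_linear_inner_left] smooth_on_frechet_derivative assms)
  show ?thesis
    by (rule smooth_on_cong[THEN iffD2, OF assms(1) _ sum]) (rule eq)
qed

section \<open>Connections and their Christoffel symbols\<close>

lemma koszulD:
  assumes "koszul_connection M D" "smooth_on M X" "smooth_on M Y" "p \<in> M"
  shows "smooth_on M X' \<Longrightarrow> D (\<lambda>q. X q + X' q) Y p = D X Y p + D X' Y p"
    and "smooth_on M f \<Longrightarrow> D (\<lambda>q. f q *\<^sub>R X q) Y p = f p *\<^sub>R D X Y p"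
    and "smooth_on M Y' \<Longrightarrow> D X (\<lambda>q. Y q + Y' q) p = D X Y p + D X Y' p"
    and "smooth_on M f \<Longrightarrow> D X (\<lambda>q. f q *\<^sub>R Y q) p =
      f p *\<^sub>R D X Y p + frechet_derivative f (at p) (X p) *\<^sub>R Y p"
proof -
  note K = assms(1)[unfolded koszul_connection_def, THEN conjunct2]
  show "smooth_on M X' \<Longrightarrow> D (\<lambda>q. X q + X' q) Y p = D X Y p + D X' Y p"
    by (rule K[THEN conjunct1, rule_format, OF assms(2) _ assms(3,4)])
  show "smooth_on M f \<Longrightarrow> D (\<lambda>q. f q *\<^sub>R X q) Y p = f p *\<^sub>R D X Y p"
    by (rule K[THEN conjunct2, THEN conjunct1, rule_format, OF _ assms(2-4)])
  show "smooth_on M Y' \<Longrightarrow> D X (\<lambda>q. Y q + Y' q) p = D X Y p + D X Y' p"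
    by (rule K[THEN conjunct2, THEN conjunct2, THEN conjunct1, rule_format, OF assms(2,3) _ assms(4)])
  show "smooth_on M f \<Longrightarrow> D X (\<lambda>q. f q *\<^sub>R Y q) p =
      f p *\<^sub>R D X Y p + frechet_derivative f (at p) (X p) *\<^sub>R Y p"
    by (rule K[THEN conjunct2, THEN conjunct2, THEN conjunct2, rule_format, OF _ assms(2-4)])
qed

context
  fixes M :: "'a::euclidean_space set" and D :: "'a connection"
  assumes K: "koszul_connection M D" and M: "open M"
begin

lemma koszul_sum_left:
  fixes f :: "'i \<Rightarrow> 'a \<Rightarrow> real"
  assumes "p \<in> M" "smooth_on M Y" "finite I"
    and "\<And>i. i \<in> I \<Longrightarrow> smooth_on M (f i)" "\<And>i. i \<in> I \<Longrightarrow> smooth_on M (Z i)"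
  shows "D (\<lambda>q. \<Sum>i\<in>I. f i q *\<^sub>R Z i q) Y p = (\<Sum>i\<in>I. f i p *\<^sub>R D (Z i) Y p)"
  using assms(3-)
proof (induction I rule: finite_induct)
  case empty
  have "D (\<lambda>q. (\<lambda>_. 0) q *\<^sub>R (0 :: 'a)) Y p = (\<lambda>_. 0) p *\<^sub>R D (\<lambda>_. 0) Y p"
    by (rule koszulD(2)[OF K smooth_on_const[OF M] assms(2,1) smooth_on_const[OF M]])
  then show ?case
    by simp
next
  case (insert i I)
  have s: "smooth_on M (\<lambda>q. f i q *\<^sub>R Z i q)" "smooth_on M (\<lambda>q. \<Sum>i\<in>I. f i q *\<^sub>R Z i q)"
    using insert.prems by (intro smooth_on_intros M; simp)+
  have "D (\<lambda>q. f i q *\<^sub>R Z i q + (\<Sum>i\<in>I. f i q *\<^sub>R Z i q)) Y p =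
      D (\<lambda>q. f i q *\<^sub>R Z i q) Y p + D (\<lambda>q. \<Sum>i\<in>I. f i q *\<^sub>R Z i q) Y p"
    by (rule koszulD(1)[OF K s(1) assms(2,1) s(2)])
  moreover have "D (\<lambda>q. f i q *\<^sub>R Z i q) Y p = f i p *\<^sub>R D (Z i) Y p"
    by (rule koszulD(2)[OF K _ assms(2,1)]) (use insert.prems in auto)
  ultimately show ?case
    using insert by simp
qed

lemma koszul_sum_right:
  fixes f :: "'i \<Rightarrow> 'a \<Rightarrow> real"
  assumes "p \<in> M" "smooth_on M X" "finite I"
    and "\<And>i. i \<in> I \<Longrightarrow> smooth_on M (f i)" "\<And>i. i \<in> I \<Longrightarrow> smooth_on M (Z i)"
  shows "D X (\<lambda>q. \<Sum>i\<in>I. f i q *\<^sub>R Z i q) p =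
    (\<Sum>i\<in>I. f i p *\<^sub>R D X (Z i) p + frechet_derivative (f i) (at p) (X p) *\<^sub>R Z i p)"
  using assms(3-)
proof (induction I rule: finite_induct)
  case empty
  have "D X (\<lambda>q. (\<lambda>_. 0) q *\<^sub>R (0 :: 'a)) p =
      (\<lambda>_. 0) p *\<^sub>R D X (\<lambda>_. 0) p + frechet_derivative (\<lambda>_. 0 :: real) (at p) (X p) *\<^sub>R 0"
    by (rule koszulD(4)[OF K assms(2) smooth_on_const[OF M] assms(1) smooth_on_const[OF M]])
  then show ?case
    by simp
next
  case (insert i I)
  have s: "smooth_on M (\<lambda>q. f i q *\<^sub>R Z i q)" "smooth_on M (\<lambda>q. \<Sum>i\<in>I. f i q *\<^sub>R Z i q)"
    using insert.prems by (intro smooth_on_intros M; simp)+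
  have "D X (\<lambda>q. f i q *\<^sub>R Z i q + (\<Sum>i\<in>I. f i q *\<^sub>R Z i q)) p =
      D X (\<lambda>q. f i q *\<^sub>R Z i q) p + D X (\<lambda>q. \<Sum>i\<in>I. f i q *\<^sub>R Z i q) p"
    by (rule koszulD(3)[OF K assms(2) s(1) assms(1) s(2)])
  moreover have "D X (\<lambda>q. f i q *\<^sub>R Z i q) p =
      f i p *\<^sub>R D X (Z i) p + frechet_derivative (f i) (at p) (X p) *\<^sub>R Z i p"
    by (rule koszulD(4)[OF K assms(2) _ assms(1)]) (use insert.prems in auto)
  ultimately show ?case
    using insert by simp
qed

lemma bilinear_christoffel:
  assumes "p \<in> M"
  shows "bilinear (christoffel D p)"
proof -
  have add: "christoffel D p (u + u') v = christoffel D p u v + christoffel D p u' v"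
    "christoffel D p u (v + v') = christoffel D p u v + christoffel D p u v'" for u u' v v'
    unfolding christoffel_def using assms
    by (auto intro!: koszulD(1)[OF K] koszulD(3)[OF K] smooth_on_const[OF M])
  note const = smooth_on_const[OF M]
  have "D (\<lambda>q. c *\<^sub>R u) (\<lambda>_. v) p = c *\<^sub>R D (\<lambda>_. u) (\<lambda>_. v) p" for c u v
    by (rule koszulD(2)[OF K const const assms const])
  moreover have "D (\<lambda>_. u) (\<lambda>q. c *\<^sub>R v) p =
      c *\<^sub>R D (\<lambda>_. u) (\<lambda>_. v) p + frechet_derivative (\<lambda>_. c) (at p) u *\<^sub>R v" for c u v
    by (rule koszulD(4)[OF K const const assms const])
  ultimately have "christoffel D p (c *\<^sub>R u) v = c *\<^sub>R christoffel D p u v"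
    "christoffel D p u (c *\<^sub>R v) = c *\<^sub>R christoffel D p u v" for c u v
    by (simp_all add: christoffel_def)
  with add show ?thesis
    unfolding bilinear_def by (auto intro!: linearI)
qed

text \<open>
  In coordinates a connection is the flat connection plus its Christoffel symbols: expand both fields
  in the constant coordinate fields and apply tensoriality on the left and the Leibniz rule on the
  right. All invariance and uniqueness questions thereby become algebra with Christoffel symbols.
\<close>

lemma koszul_eq_christoffel:
  assumes "p \<in> M" "smooth_on M X" "smooth_on M Y"
  shows "D X Y p = frechet_derivative Y (at p) (X p) + christoffel D p (X p) (Y p)"
proof -
  have linX: "D X (\<lambda>_. c) p = christoffel D p (X p) c" for c
  proof -
    have "D X (\<lambda>_. c) p = D (\<lambda>q. \<Sum>b\<in>Basis. (X q \<bullet> b) *\<^sub>R b) (\<lambda>_. c) p"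
      by (simp add: euclidean_representation)
    also have "\<dots> = (\<Sum>b\<in>Basis. (X p \<bullet> b) *\<^sub>R christoffel D p b c)"
      unfolding christoffel_def
      by (rule koszul_sum_left) (intro assms smooth_on_intros M finite_Basis)+
    also have "\<dots> = christoffel D p (X p) c"
      using linear_eq_sum_Basis[of "\<lambda>u. christoffel D p u c" "X p"] bilinear_christoffel[OF assms(1)]
      by (simp add: bilinear_def)
    finally show ?thesis .
  qed
  have Y': "frechet_derivative (\<lambda>q. Y q \<bullet> b) (at p) = (\<lambda>v. frechet_derivative Y (at p) v \<bullet> b)" for b
    by (rule frechet_derivative_at[symmetric]
        bounded_linear.has_derivative[OF bounded_linear_inner_left] smooth_on_has_derivative assms)+
  have "D X Y p = D X (\<lambda>q. \<Sum>b\<in>Basis. (Y q \<bullet> b) *\<^sub>R b) p"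
    by (simp add: euclidean_representation)
  also have "\<dots> = (\<Sum>b\<in>Basis. (Y p \<bullet> b) *\<^sub>R D X (\<lambda>_. b) p +
      frechet_derivative (\<lambda>q. Y q \<bullet> b) (at p) (X p) *\<^sub>R b)"
    by (rule koszul_sum_right) (intro assms smooth_on_intros M finite_Basis)+
  also have "\<dots> = (\<Sum>b\<in>Basis. (Y p \<bullet> b) *\<^sub>R christoffel D p (X p) b) + frechet_derivative Y (at p) (X p)"
    unfolding linX Y' by (simp add: sum.distrib euclidean_representation)
  also have "(\<Sum>b\<in>Basis. (Y p \<bullet> b) *\<^sub>R christoffel D p (X p) b) = christoffel D p (X p) (Y p)"
    using linear_eq_sum_Basis[of "christoffel D p (X p)" "Y p"] bilinear_christoffel[OF assms(1)]
    by (simp add: bilinear_def)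
  finally show ?thesis
    by simp
qed

lemma torsion_free_iff_christoffel:
  "torsion_free M D \<longleftrightarrow> (\<forall>p\<in>M. \<forall>u v. christoffel D p u v = christoffel D p v u)"
proof
  assume T: "torsion_free M D"
  show "\<forall>p\<in>M. \<forall>u v. christoffel D p u v = christoffel D p v u"
  proof (intro ballI allI)
    fix p u v
    assume "p \<in> M"
    then have "D (\<lambda>_. u) (\<lambda>_. v) p - D (\<lambda>_. v) (\<lambda>_. u) p = lie_bracket (\<lambda>_. u) (\<lambda>_. v) p"
      using T smooth_on_const[OF M] unfolding torsion_free_def by blast
    then show "christoffel D p u v = christoffel D p v u"
      by (simp add: christoffel_def lie_bracket_def)
  qed
qed (auto simp: torsion_free_def lie_bracket_def koszul_eq_christoffel)

text \<open>
  An affine map preserves the flat part of a connection, so it preserves the connection if and only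
  if its linear part intertwines the Christoffel symbols.
\<close>

lemma invariant_under_affine_iff:
  fixes A B :: "'a \<Rightarrow> 'a"
  assumes A: "bounded_linear A" and B: "bounded_linear B"
    and BA: "\<And>x. B (A x) = x" and AB: "\<And>x. A (B x) = x"
    and \<phi>: "\<And>p. p \<in> M \<Longrightarrow> \<phi> p = A p + c" and bij: "\<phi> ` M = M"
  shows "invariant_under M \<phi> D \<longleftrightarrow>
    (\<forall>p\<in>M. \<forall>u v. christoffel D (\<phi> p) (A u) (A v) = A (christoffel D p u v))"
proof -
  have linA: "linear A"
    using A by (rule bounded_linear.linear)
  have \<phi>M: "\<phi> q \<in> M" if "q \<in> M" for q
    using bij that by blast
  have inj: "inj_on \<phi> M"
  proof (rule inj_onI)
    fix x y
    assume "x \<in> M" "y \<in> M" "\<phi> x = \<phi> y"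
    then have "B (A x) = B (A y)"
      by (simp add: \<phi>)
    then show "x = y"
      by (simp only: BA)
  qed
  have inv: "the_inv_into M \<phi> (\<phi> q) = q" if "q \<in> M" for q
    using inj that by (rule the_inv_into_f_f)
  have \<phi>': "frechet_derivative \<phi> (at q) = A" if "q \<in> M" for q
  proof -
    have "((\<lambda>p. A p + c) has_derivative A) (at q)"
      by (rule has_derivative_add_const[OF bounded_linear_imp_has_derivative[OF A]])
    then have "(\<phi> has_derivative A) (at q)"
      by (rule has_derivative_transform_within_open[OF _ M that]) (simp add: \<phi>)
    then show ?thesis
      by (rule frechet_derivative_at[symmetric])
  qed
  have push: "pushforward M \<phi> X (\<phi> q) = A (X q)" if "q \<in> M" for X q
    using that by (simp add: pushforward_def inv \<phi>')
  have inverse: "\<phi> (B p + - B c) = p" "B p + - B c \<in> M" if p: "p \<in> M" for p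
  proof -
    obtain q where q: "q \<in> M" "p = \<phi> q"
      using bij p by blast
    have "B p + - B c = q"
      using q(1) unfolding q(2) \<phi>[OF q(1)]
      by (simp add: linear_add[OF bounded_linear.linear[OF B]] BA)
    then show "\<phi> (B p + - B c) = p" "B p + - B c \<in> M"
      using q by auto
  qed
  have push_eq: "pushforward M \<phi> X p = A (X (B p + - B c))" if "p \<in> M" for X p
    using push[OF inverse(2)[OF that], of X] inverse(1)[OF that] by simp
  have smooth: "smooth_on M (pushforward M \<phi> X)" if X: "smooth_on M X" for X
  proof -
    have "smooth_on M (\<lambda>p. B p + - B c)"
      by (rule smooth_on_add[OF M smooth_on_linear[OF M B smooth_on_id[OF M]] smooth_on_const[OF M]])
    then have "smooth_on M (\<lambda>p. X (B p + - B c))"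
      by (rule smooth_on_compose[OF M X]) (use inverse(2) in auto)
    then have "smooth_on M (\<lambda>p. A (X (B p + - B c)))"
      by (rule smooth_on_linear[OF M A])
    then show ?thesis
      using smooth_on_cong[OF M, of "pushforward M \<phi> X" "\<lambda>p. A (X (B p + - B c))"] push_eq by simp
  qed
  have key: "D (pushforward M \<phi> X) (pushforward M \<phi> Y) (\<phi> q) - pushforward M \<phi> (D X Y) (\<phi> q) =
      christoffel D (\<phi> q) (A (X q)) (A (Y q)) - A (christoffel D q (X q) (Y q))"
    if q: "q \<in> M" and X: "smooth_on M X" and Y: "smooth_on M Y" for q X Y
  proof -
    have "B (\<phi> q) + - B c = q"
      unfolding \<phi>[OF q] by (simp add: linear_add[OF bounded_linear.linear[OF B]] BA)
    then have "(Y has_derivative frechet_derivative Y (at q)) (at (B (\<phi> q) + - B c))"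
      using smooth_on_has_derivative[OF Y q] by simp
    then have "((\<lambda>p. A (Y (B p + - B c))) has_derivative (\<lambda>v. A (frechet_derivative Y (at q) (B v)))) (at (\<phi> q))"
      by (rule bounded_linear.has_derivative[OF A has_derivative_compose[OF
              has_derivative_add_const[OF bounded_linear_imp_has_derivative[OF B]]]])
    then have "(pushforward M \<phi> Y has_derivative (\<lambda>v. A (frechet_derivative Y (at q) (B v)))) (at (\<phi> q))"
      by (rule has_derivative_transform_within_open[OF _ M \<phi>M[OF q]]) (simp add: push_eq)
    then have "frechet_derivative (pushforward M \<phi> Y) (at (\<phi> q)) (A (X q)) =
        A (frechet_derivative Y (at q) (X q))"
      by (simp add: frechet_derivative_at[symmetric] BA)
    then show ?thesis
      using koszul_eq_christoffel[OF \<phi>M[OF q] smooth[OF X] smooth[OF Y]]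
        koszul_eq_christoffel[OF q X Y]
      by (simp add: push q linear_add[OF linA])
  qed
  show ?thesis
  proof
    assume I: "invariant_under M \<phi> D"
    show "\<forall>p\<in>M. \<forall>u v. christoffel D (\<phi> p) (A u) (A v) = A (christoffel D p u v)"
    proof (intro ballI allI)
      fix p u v
      assume p: "p \<in> M"
      have "D (pushforward M \<phi> (\<lambda>_. u)) (pushforward M \<phi> (\<lambda>_. v)) (\<phi> p) =
          pushforward M \<phi> (D (\<lambda>_. u) (\<lambda>_. v)) (\<phi> p)"
        by (rule I[unfolded invariant_under_def, rule_format,
              OF smooth_on_const[OF M] smooth_on_const[OF M] \<phi>M[OF p]])
      then show "christoffel D (\<phi> p) (A u) (A v) = A (christoffel D p u v)"
        using key[OF p smooth_on_const[OF M] smooth_on_const[OF M], of u v] by simp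
    qed
  next
    assume *: "\<forall>p\<in>M. \<forall>u v. christoffel D (\<phi> p) (A u) (A v) = A (christoffel D p u v)"
    show "invariant_under M \<phi> D"
      unfolding invariant_under_def
    proof (intro allI impI ballI)
      fix X Y :: "'a \<Rightarrow> 'a" and p
      assume X: "smooth_on M X" and Y: "smooth_on M Y" and p: "p \<in> M"
      obtain q where q: "q \<in> M" "p = \<phi> q"
        using bij p by blast
      then show "D (pushforward M \<phi> X) (pushforward M \<phi> Y) p = pushforward M \<phi> (D X Y) p"
        using key[OF q(1) X Y] * by simp
    qed
  qed
qed

end

text \<open>Conversely, every smooth field of bilinear maps is the Christoffel symbol of a connection.\<close>
definition connection_of :: "('a::euclidean_space \<Rightarrow> 'a \<Rightarrow> 'a \<Rightarrow> 'a) \<Rightarrow> 'a connection" where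
  "connection_of \<Gamma> X Y p = frechet_derivative Y (at p) (X p) + \<Gamma> p (X p) (Y p)"

lemma christoffel_connection_of: "christoffel (connection_of \<Gamma>) = \<Gamma>"
  by (simp add: christoffel_def connection_of_def fun_eq_iff)

lemma koszul_connection_of:
  assumes M: "open M" and lin: "\<And>p. p \<in> M \<Longrightarrow> bilinear (\<Gamma> p)"
    and smooth: "\<And>X Y. smooth_on M X \<Longrightarrow> smooth_on M Y \<Longrightarrow> smooth_on M (\<lambda>p. \<Gamma> p (X p) (Y p))"
  shows "koszul_connection M (connection_of \<Gamma>)"
  unfolding koszul_connection_def
proof (intro conjI allI impI ballI)
  show "smooth_on M (connection_of \<Gamma> X Y)" if "smooth_on M X" "smooth_on M Y" for X Y
    unfolding connection_of_def
    by (intro smooth_on_add[OF M] smooth_on_derivative_along[OF M] smooth that)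
next
  fix X X' Y :: "'a \<Rightarrow> 'a" and p
  assume Y: "smooth_on M Y" and p: "p \<in> M"
  show "connection_of \<Gamma> (\<lambda>q. X q + X' q) Y p = connection_of \<Gamma> X Y p + connection_of \<Gamma> X' Y p"
    using bounded_linear.linear[OF bounded_linear_frechet_derivative[OF Y p]]
    by (simp add: connection_of_def linear_add bilinear_ladd[OF lin[OF p]])
next
  fix f :: "'a \<Rightarrow> real" and X Y :: "'a \<Rightarrow> 'a" and p
  assume Y: "smooth_on M Y" and p: "p \<in> M"
  show "connection_of \<Gamma> (\<lambda>q. f q *\<^sub>R X q) Y p = f p *\<^sub>R connection_of \<Gamma> X Y p"
    using bounded_linear.linear[OF bounded_linear_frechet_derivative[OF Y p]]
    by (simp add: connection_of_def linear_scale bilinear_lmul[OF lin[OF p]] scaleR_add_right)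
next
  fix X Y Y' :: "'a \<Rightarrow> 'a" and p
  assume Y: "smooth_on M Y" "smooth_on M Y'" and p: "p \<in> M"
  show "connection_of \<Gamma> X (\<lambda>q. Y q + Y' q) p = connection_of \<Gamma> X Y p + connection_of \<Gamma> X Y' p"
    using frechet_derivative_at[OF has_derivative_add[OF Y[THEN smooth_on_has_derivative, OF p]], symmetric]
    by (simp add: connection_of_def bilinear_radd[OF lin[OF p]])
next
  fix f :: "'a \<Rightarrow> real" and X Y :: "'a \<Rightarrow> 'a" and p
  assume f: "smooth_on M f" and Y: "smooth_on M Y" and p: "p \<in> M"
  show "connection_of \<Gamma> X (\<lambda>q. f q *\<^sub>R Y q) p =
      f p *\<^sub>R connection_of \<Gamma> X Y p + frechet_derivative f (at p) (X p) *\<^sub>R Y p"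
    using frechet_derivative_at[OF has_derivative_scaleR[OF smooth_on_has_derivative[OF f p]
          smooth_on_has_derivative[OF Y p]], symmetric]
    by (simp add: connection_of_def bilinear_rmul[OF lin[OF p]] algebra_simps)
qed

section \<open>Invariant connections on the group\<close>

lemma open_half_space: "open (half_space :: 'n::finite acoord set)"
  unfolding half_space_def by (intro open_Collect_less continuous_intros)

text \<open>
  The Lie algebra in the coordinates \<open>(x\<^sub>0, x\<^sub>v)\<close>. In the chart the left invariant field of \<open>x\<close> is
  \<open>(r, b) \<mapsto> r x\<close>.
\<close>
definition lie_elem :: "'n::finite acoord \<Rightarrow> 'n amat" where
  "lie_elem x = fst x *\<^sub>R e0 + vec_part (snd x)"

lemma left_field_lie_elem: "left_field (lie_elem x) = (\<lambda>q. fst q *\<^sub>R x)"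
  by (rule ext) (simp add: lie_elem_def left_field_eq prod_eq_iff)

lemma vec_part_linear: "c *\<^sub>R vec_part x + d *\<^sub>R vec_part y = vec_part (c *\<^sub>R x + d *\<^sub>R y)"
  by (auto simp: vec_eq_iff vec_part_nth split: option.split)

lemma form1_eq_form2:
  assumes "xv \<in> V_sub" "yv \<in> V_sub"
  shows "form1 a x0 xv y0 yv = form2 a x0 xv y0 yv"
  unfolding form1_def form2_def mat_bracket_eq[OF assms]
  by (simp add: vec_eq_iff diff_divide_distrib add_divide_distrib ring_distribs)

lemma form2_lie_elem:
  "form2 a (fst x) (vec_part (snd x)) (fst y) (vec_part (snd y)) =
    lie_elem (((a + 1) / 2 * fst x) *\<^sub>R y + ((a - 1) / 2 * fst y) *\<^sub>R x)"
  unfolding form2_def lie_elem_def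
  by (simp add: vec_part_linear[symmetric] algebra_simps)

lemma satisfies_formula_iff:
  "satisfies_formula a D \<longleftrightarrow> (\<forall>x y. \<forall>p\<in>half_space.
    D (\<lambda>q. fst q *\<^sub>R x) (\<lambda>q. fst q *\<^sub>R y) p =
      fst p *\<^sub>R (((a + 1) / 2 * fst x) *\<^sub>R y + ((a - 1) / 2 * fst y) *\<^sub>R x))"
proof -
  have "satisfies_formula a D \<longleftrightarrow> (\<forall>x y. \<forall>p\<in>half_space.
    D (left_field (lie_elem x)) (left_field (lie_elem y)) p =
      left_field (form1 a (fst x) (vec_part (snd x)) (fst y) (vec_part (snd y))) p)"
    unfolding satisfies_formula_def V_sub_eq lie_elem_def by (auto simp: split_paired_all)
  then show ?thesis
    by (simp add: form1_eq_form2 V_sub_eq form2_lie_elem left_field_lie_elem)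
qed

text \<open>
  The connection defined by the formula, on left invariant fields, has these Christoffel symbols: at
  \<open>(r, b)\<close> the flat connection contributes \<open>r x\<^sub>0 y\<close> to the derivative of \<open>r y\<close> along \<open>r x\<close>, and what the
  formula adds to this is symmetric in \<open>x\<close> and \<open>y\<close>. Its geodesics satisfy
  \<open>\<gamma>'' = - (a - 1) (r'/r) \<gamma>'\<close>, so they are reparametrized straight lines.
\<close>
definition aff_christoffel :: "real \<Rightarrow> 'n::finite acoord \<Rightarrow> 'n acoord \<Rightarrow> 'n acoord \<Rightarrow> 'n acoord" where
  "aff_christoffel a p u v = ((a - 1) / (2 * fst p)) *\<^sub>R (fst u *\<^sub>R v + fst v *\<^sub>R u)"

text \<open>
  The left invariant fields span every tangent space, so a connection that satisfies the formula is
  determined by it.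
\<close>
lemma satisfies_formula_iff_christoffel:
  fixes D :: "'n::finite acoord connection"
  assumes K: "koszul_connection half_space D"
  shows "satisfies_formula a D \<longleftrightarrow>
    (\<forall>p\<in>half_space. \<forall>x y. christoffel D p x y = aff_christoffel a p x y)"
proof -
  have iff: "D (\<lambda>q. fst q *\<^sub>R x) (\<lambda>q. fst q *\<^sub>R y) p =
      fst p *\<^sub>R (((a + 1) / 2 * fst x) *\<^sub>R y + ((a - 1) / 2 * fst y) *\<^sub>R x) \<longleftrightarrow>
      christoffel D p x y = aff_christoffel a p x y"
    if p: "p \<in> half_space" for p x y :: "'n acoord"
  proof -
    have r: "fst p > 0"
      using p by (simp add: half_space_def)
    have smooth: "smooth_on half_space (\<lambda>q. fst q *\<^sub>R z)" for z :: "'n acoord"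
      by (intro smooth_on_bilinear[OF _ bounded_bilinear_scaleR] smooth_on_const
          smooth_on_linear[OF _ bounded_linear_fst] smooth_on_id open_half_space)
    have "((\<lambda>q. fst q *\<^sub>R y) has_derivative (\<lambda>v. fst v *\<^sub>R y)) (at p)"
      by (auto intro!: derivative_eq_intros)
    then have "frechet_derivative (\<lambda>q. fst q *\<^sub>R y) (at p) = (\<lambda>v. fst v *\<^sub>R y)"
      by (rule frechet_derivative_at[symmetric])
    then have D: "D (\<lambda>q. fst q *\<^sub>R x) (\<lambda>q. fst q *\<^sub>R y) p =
        (fst p * fst x) *\<^sub>R y + (fst p)\<^sup>2 *\<^sub>R christoffel D p x y"
      using koszul_eq_christoffel[OF K open_half_space p smooth smooth, of x y]
        bilinear_christoffel[OF K open_half_space p]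
      by (simp add: bilinear_lmul bilinear_rmul power2_eq_square)
    have "fst p *\<^sub>R (((a + 1) / 2 * fst x) *\<^sub>R y + ((a - 1) / 2 * fst y) *\<^sub>R x) =
        (fst p * fst x) *\<^sub>R y + (fst p)\<^sup>2 *\<^sub>R aff_christoffel a p x y"
      using r by (simp add: aff_christoffel_def prod_eq_iff vec_eq_iff power2_eq_square field_simps)
    then show ?thesis
      unfolding D using r by simp
  qed
  show ?thesis
    unfolding satisfies_formula_iff using iff by blast
qed

text \<open>
  Right translations are the restrictions of linear maps, left translations of homotheties followed
  by translations; so the criterion for affine maps applies to both.
\<close>
definition right_linear :: "'n::finite acoord \<Rightarrow> 'n acoord \<Rightarrow> 'n acoord" where
  "right_linear g u = (fst g * fst u, snd u + fst u *\<^sub>R snd g)"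

lemma left_trans_affine:
  "g \<in> half_space \<Longrightarrow> p \<in> half_space \<Longrightarrow> left_trans (aff_matrix g) p = fst g *\<^sub>R p + (0, snd g)"
  by (simp add: left_right_trans_eq prod_eq_iff)

lemma right_trans_linear:
  "g \<in> half_space \<Longrightarrow> p \<in> half_space \<Longrightarrow> right_trans (aff_matrix g) p = right_linear g p"
  by (simp add: left_right_trans_eq prod_eq_iff right_linear_def)

lemma left_invariant_iff:
  fixes D :: "'n::finite acoord connection"
  assumes K: "koszul_connection half_space D"
  shows "left_invariant D \<longleftrightarrow> (\<forall>g\<in>half_space. \<forall>p\<in>half_space. \<forall>u v.
    christoffel D (fst g *\<^sub>R p + (0, snd g)) (fst g *\<^sub>R u) (fst g *\<^sub>R v) = fst g *\<^sub>R christoffel D p u v)"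
proof -
  have "invariant_under half_space (left_trans (aff_matrix g)) D \<longleftrightarrow> (\<forall>p\<in>half_space. \<forall>u v.
    christoffel D (left_trans (aff_matrix g) p) (fst g *\<^sub>R u) (fst g *\<^sub>R v) = fst g *\<^sub>R christoffel D p u v)"
    if g: "g \<in> half_space" for g :: "'n acoord"
  proof -
    have s: "fst g > 0"
      using g by (simp add: half_space_def)
    have "p \<in> left_trans (aff_matrix g) ` half_space" if p: "p \<in> half_space" for p
    proof
      let ?q = "(1 / fst g) *\<^sub>R (p - (0, snd g))"
      show "?q \<in> half_space"
        using p s by (simp add: half_space_def)
      then show "p = left_trans (aff_matrix g) ?q"
        using s g by (simp add: left_trans_affine)
    qed
    moreover have "left_trans (aff_matrix g) p \<in> half_space" if "p \<in> half_space" for p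
      using that s g unfolding left_trans_affine[OF g that] by (simp add: half_space_def)
    ultimately have "left_trans (aff_matrix g) ` half_space = half_space"
      by blast
    then show ?thesis
      using s by (intro invariant_under_affine_iff[OF K open_half_space bounded_linear_scaleR_right
            bounded_linear_scaleR_right[of "1 / fst g"] _ _ left_trans_affine[OF g]]) auto
  qed
  then show ?thesis
    unfolding left_invariant_def aff_group_def by (simp add: left_trans_affine)
qed

lemma right_invariant_iff:
  fixes D :: "'n::finite acoord connection"
  assumes K: "koszul_connection half_space D"
  shows "right_invariant D \<longleftrightarrow> (\<forall>g\<in>half_space. \<forall>p\<in>half_space. \<forall>u v.
    christoffel D (right_linear g p) (right_linear g u) (right_linear g v) =
    right_linear g (christoffel D p u v))"
proof -
  have "invariant_under half_space (right_trans (aff_matrix g)) D \<longleftrightarrow> (\<forall>p\<in>half_space. \<forall>u v.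
    christoffel D (right_trans (aff_matrix g) p) (right_linear g u) (right_linear g v) =
    right_linear g (christoffel D p u v))"
    if g: "g \<in> half_space" for g :: "'n acoord"
  proof -
    have s: "fst g > 0"
      using g by (simp add: half_space_def)
    define h :: "'n acoord" where "h = (1 / fst g, - (1 / fst g) *\<^sub>R snd g)"
    have hg: "right_linear h (right_linear g u) = u" "right_linear g (right_linear h u) = u" for u
      using s by (simp_all add: right_linear_def h_def prod_eq_iff)
    have lin: "bounded_linear (right_linear k)" for k :: "'n acoord"
      unfolding right_linear_def
      by (intro bounded_linear_Pair bounded_linear_add bounded_linear_snd
          bounded_linear_const_mult[OF bounded_linear_fst]
          bounded_linear_scaleR_const[OF bounded_linear_fst])
    have "p \<in> right_trans (aff_matrix g) ` half_space" if p: "p \<in> half_space" for p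
    proof
      show "right_linear h p \<in> half_space"
        using p s by (simp add: half_space_def right_linear_def h_def)
      then show "p = right_trans (aff_matrix g) (right_linear h p)"
        using g by (simp add: right_trans_linear hg)
    qed
    moreover have "right_trans (aff_matrix g) p \<in> half_space" if "p \<in> half_space" for p
      using that s g unfolding right_trans_linear[OF g that] by (simp add: half_space_def right_linear_def)
    ultimately have "right_trans (aff_matrix g) ` half_space = half_space"
      by blast
    then show ?thesis
      by (intro invariant_under_affine_iff[OF K open_half_space lin lin[of h] hg, where c = 0])
        (simp_all add: right_trans_linear g)
  qed
  then show ?thesis
    unfolding right_invariant_def aff_group_def by (simp add: right_trans_linear)
qed

text \<open>
  Both kinds of translations multiply \<open>r\<close> and the first coordinate of a tangent vector by the same
  factor, and the Christoffel symbols use nothing else besides the vector space structure.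
\<close>
lemma biinvariant_if_aff_christoffel:
  fixes D :: "'n::finite acoord connection"
  assumes K: "koszul_connection half_space D"
    and \<Gamma>: "\<And>p u v. p \<in> half_space \<Longrightarrow> christoffel D p u v = aff_christoffel a p u v"
  shows "biinvariant D"
  unfolding biinvariant_def left_invariant_iff[OF K] right_invariant_iff[OF K]
proof (intro conjI ballI allI)
  fix g p u v :: "'n acoord"
  assume g: "g \<in> half_space" and p: "p \<in> half_space"
  then have pos: "fst g > 0" "fst p > 0"
    by (simp_all add: half_space_def)
  have "fst g *\<^sub>R p + (0, snd g) \<in> half_space" "right_linear g p \<in> half_space"
    using pos by (simp_all add: half_space_def right_linear_def)
  then show "christoffel D (fst g *\<^sub>R p + (0, snd g)) (fst g *\<^sub>R u) (fst g *\<^sub>R v) = fst g *\<^sub>R christoffel D p u v"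
    and "christoffel D (right_linear g p) (right_linear g u) (right_linear g v) =
      right_linear g (christoffel D p u v)"
    using p pos
    by (simp_all add: \<Gamma> aff_christoffel_def right_linear_def prod_eq_iff vec_eq_iff field_simps)
qed

text \<open>
  By left invariance the Christoffel symbols are \<open>B / r\<close> with \<open>B\<close> their value at the identity, and right
  invariance becomes an equivariance of the bilinear map \<open>B\<close>, which is symmetric because the torsion
  vanishes. Dilations leave only the components of \<open>B(e\<^sub>0, e\<^sub>0)\<close> along \<open>e\<^sub>0\<close> and of \<open>B(e\<^sub>0, V)\<close> along \<open>V\<close>;
  the unipotent translations express the second by the first, so one real parameter remains.
\<close>
lemma aff_christoffel_if_biinvariant:
  fixes D :: "'n::finite acoord connection"
  assumes K: "koszul_connection half_space D" and bi: "biinvariant D"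
    and tf: "torsion_free half_space D"
  shows "\<exists>a. \<forall>p\<in>half_space. \<forall>u v. christoffel D p u v = aff_christoffel a p u v"
proof -
  define B where "B = christoffel D (1, 0)"
  have one: "(1, 0) \<in> half_space"
    by (simp add: half_space_def)
  have bil: "bilinear B"
    unfolding B_def by (rule bilinear_christoffel[OF K open_half_space one])
  have sym: "B u v = B v u" for u v
    using tf one unfolding torsion_free_iff_christoffel[OF K open_half_space] B_def by blast
  have left: "christoffel D p u v = (1 / fst p) *\<^sub>R B u v" if p: "p \<in> half_space" for p u v
  proof -
    have r: "fst p > 0"
      using p by (simp add: half_space_def)
    have "left_invariant D"
      using bi by (simp add: biinvariant_def)
    then have "christoffel D (fst p *\<^sub>R (1, 0) + (0, snd p)) (fst p *\<^sub>R (1 / fst p) *\<^sub>R u)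
        (fst p *\<^sub>R (1 / fst p) *\<^sub>R v) = fst p *\<^sub>R B ((1 / fst p) *\<^sub>R u) ((1 / fst p) *\<^sub>R v)"
      using p one unfolding left_invariant_iff[OF K] B_def by blast
    then show ?thesis
      using r by (simp add: bilinear_lmul[OF bil] bilinear_rmul[OF bil])
  qed
  have right: "B (right_linear g u) (right_linear g v) = fst g *\<^sub>R right_linear g (B u v)"
    if g: "g \<in> half_space" for g u v
  proof -
    have s: "fst g > 0"
      using g by (simp add: half_space_def)
    have "right_linear g (1, 0) \<in> half_space" "fst (right_linear g (1, 0)) = fst g"
      using s by (simp_all add: half_space_def right_linear_def)
    moreover have "christoffel D (right_linear g (1, 0)) (right_linear g u) (right_linear g v) =
        right_linear g (B u v)"
      using bi g one unfolding biinvariant_def right_invariant_iff[OF K] B_def by blast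
    ultimately have "(1 / fst g) *\<^sub>R B (right_linear g u) (right_linear g v) = right_linear g (B u v)"
      by (simp add: left)
    then have "fst g *\<^sub>R (1 / fst g) *\<^sub>R B (right_linear g u) (right_linear g v) = fst g *\<^sub>R right_linear g (B u v)"
      by simp
    then show ?thesis
      using s by simp
  qed
  \<comment> \<open>The dilation by 2 acts with different weights on \<open>e\<^sub>0\<close> and on \<open>V\<close>, which forces components of \<open>B\<close>
    with the wrong weight to vanish.\<close>
  have two: "(2, 0) \<in> half_space"
    by (simp add: half_space_def)
  have rl2: "right_linear (2, 0) (0, b) = (0, b)" "right_linear (2, 0) (1, 0) = 2 *\<^sub>R (1, 0)" for b :: "real^'n"
    by (simp_all add: right_linear_def)
  have vv: "B (0, b) (0, c) = 0" for b c
    using right[OF two, of "(0, b)" "(0, c)"] by (simp add: rl2 right_linear_def prod_eq_iff vec_eq_iff)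
  define k where "k = fst (B (1, 0) (1, 0)) / 2"
  have ee: "B (1, 0) (1, 0) = (2 * k) *\<^sub>R (1, 0)"
  proof -
    have "2 *\<^sub>R 2 *\<^sub>R B (1, 0) (1, 0) = 2 *\<^sub>R right_linear (2, 0) (B (1, 0) (1, 0))"
      using right[OF two, of "(1, 0)" "(1, 0)"]
      by (simp only: rl2 bilinear_lmul[OF bil] bilinear_rmul[OF bil] fst_conv)
    then show ?thesis
      by (simp add: k_def right_linear_def prod_eq_iff vec_eq_iff)
  qed
  \<comment> \<open>A unipotent translation maps \<open>e\<^sub>0\<close> to \<open>e\<^sub>0 + b\<close>; polarizing \<open>B(e\<^sub>0 + b, e\<^sub>0 + b)\<close> gives the mixed terms.\<close>
  have ev: "B (1, 0) (0, b) = k *\<^sub>R (0, b)" for b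
  proof -
    have "(1, b) \<in> half_space" and rl: "right_linear (1, b) (1, 0) = (1, 0) + (0, b)"
      by (simp_all add: half_space_def right_linear_def)
    then have "B ((1, 0) + (0, b)) ((1, 0) + (0, b)) = right_linear (1, b) ((2 * k) *\<^sub>R (1, 0))"
      using right[of "(1, b)" "(1, 0)" "(1, 0)"] ee by simp
    also have "\<dots> = (2 * k) *\<^sub>R (1, 0) + (2 * k) *\<^sub>R (0, b)"
      by (simp add: right_linear_def)
    finally have "2 *\<^sub>R B (1, 0) (0, b) = (2 * k) *\<^sub>R (0, b)"
      unfolding bilinear_ladd[OF bil] bilinear_radd[OF bil] vv ee sym[of "(0, b)" "(1, 0)"]
      by (simp add: prod_eq_iff scaleR_2)
    then have "(1 / 2) *\<^sub>R 2 *\<^sub>R B (1, 0) (0, b) = (1 / 2) *\<^sub>R (2 * k) *\<^sub>R (0, b)"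
      by simp
    then show ?thesis
      by simp
  qed
  have B: "B u v = k *\<^sub>R (fst u *\<^sub>R v + fst v *\<^sub>R u)" for u v
  proof -
    have split: "w = fst w *\<^sub>R (1, 0) + (0, snd w)" for w :: "'n acoord"
      by (simp add: prod_eq_iff)
    have "B u v = B (fst u *\<^sub>R (1, 0) + (0, snd u)) (fst v *\<^sub>R (1, 0) + (0, snd v))"
      using split by metis
    also have "\<dots> = (fst u * fst v) *\<^sub>R (2 * k) *\<^sub>R (1, 0) + fst u *\<^sub>R k *\<^sub>R (0, snd v) + fst v *\<^sub>R k *\<^sub>R (0, snd u)"
      by (simp only: bilinear_ladd[OF bil] bilinear_radd[OF bil] bilinear_lmul[OF bil]
          bilinear_rmul[OF bil] vv ee ev sym[of "(0, snd u)" "(1, 0)"] scaleR_scaleR scaleR_add_right add_0_left add_0_right ac_simps)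
    also have "\<dots> = k *\<^sub>R (fst u *\<^sub>R v + fst v *\<^sub>R u)"
      by (simp add: prod_eq_iff algebra_simps)
    finally show ?thesis .
  qed
  have "christoffel D p u v = aff_christoffel (2 * k + 1) p u v" if "p \<in> half_space" for p u v
    using that by (simp add: left B aff_christoffel_def half_space_def)
  then show ?thesis
    by blast
qed

lemma koszul_aff_christoffel: "koszul_connection half_space (connection_of (aff_christoffel a :: 'n::finite acoord \<Rightarrow> _))"
proof (rule koszul_connection_of[OF open_half_space])
  fix p :: "'n acoord"
  show "bilinear (aff_christoffel a p)"
    unfolding bilinear_def aff_christoffel_def
    by (auto intro!: linearI
        simp: prod_eq_iff vec_eq_iff ring_distribs add_divide_distrib diff_divide_distrib ac_simps)
next
  fix X Y :: "'n acoord \<Rightarrow> 'n acoord"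
  assume X: "smooth_on half_space X" and Y: "smooth_on half_space Y"
  have "smooth_on half_space (\<lambda>p :: 'n acoord. inverse (fst p))"
    by (intro smooth_on_inverse smooth_on_linear[OF _ bounded_linear_fst] smooth_on_id open_half_space)
      (simp add: half_space_def)
  then have "smooth_on half_space (\<lambda>p. (((a - 1) / 2) * inverse (fst p)) *\<^sub>R
      (fst (X p) *\<^sub>R Y p + fst (Y p) *\<^sub>R X p))"
    by (intro smooth_on_add smooth_on_bilinear[OF _ bounded_bilinear_scaleR]
        smooth_on_bilinear[OF _ bounded_bilinear_mult] smooth_on_const
        smooth_on_linear[OF _ bounded_linear_fst] X Y open_half_space)
  then show "smooth_on half_space (\<lambda>p. aff_christoffel a p (X p) (Y p))"
    by (simp add: aff_christoffel_def field_simps)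
qed

section \<open>Polarizations given by closed one-forms and by frames\<close>

lemma cscale_ii: "cscale \<i> z = (- snd z, fst z)"
  by (simp add: cscale_def)

lemma has_derivative_one_form_along:
  fixes \<theta> :: "'b::euclidean_space \<Rightarrow> 'b \<Rightarrow> 'c::real_normed_vector"
  assumes "open W" "q \<in> W"
    and lin: "\<And>q. q \<in> W \<Longrightarrow> linear (\<theta> q)" and bil: "bilinear (\<theta>' q)"
    and der: "\<And>v. ((\<lambda>q. \<theta> q v) has_derivative (\<lambda>h. \<theta>' q h v)) (at q)"
    and Y: "(Y has_derivative Y') (at q)"
  shows "((\<lambda>q. \<theta> q (Y q)) has_derivative (\<lambda>h. \<theta>' q h (Y q) + \<theta> q (Y' h))) (at q)"
proof -
  have "((\<lambda>q. \<Sum>b\<in>Basis. (Y q \<bullet> b) *\<^sub>R \<theta> q b) has_derivative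
      (\<lambda>h. \<Sum>b\<in>Basis. (Y q \<bullet> b) *\<^sub>R \<theta>' q h b + (Y' h \<bullet> b) *\<^sub>R \<theta> q b)) (at q)"
    by (intro has_derivative_sum has_derivative_scaleR der
        bounded_linear.has_derivative[OF bounded_linear_inner_left] Y)
  moreover have "(\<Sum>b\<in>Basis. (Y q \<bullet> b) *\<^sub>R \<theta>' q h b + (Y' h \<bullet> b) *\<^sub>R \<theta> q b) =
      \<theta>' q h (Y q) + \<theta> q (Y' h)" for h
    using linear_eq_sum_Basis[of "\<theta>' q h" "Y q"] linear_eq_sum_Basis[OF lin[OF assms(2)], of "Y' h"] bil
    by (simp add: sum.distrib bilinear_def)
  ultimately have "((\<lambda>q. \<Sum>b\<in>Basis. (Y q \<bullet> b) *\<^sub>R \<theta> q b) has_derivative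
      (\<lambda>h. \<theta>' q h (Y q) + \<theta> q (Y' h))) (at q)"
    by simp
  then show ?thesis
    by (rule has_derivative_transform_within_open[OF _ assms(1,2)])
      (rule linear_eq_sum_Basis[OF lin, symmetric])
qed

text \<open>
  For sections \<open>Z\<close> and \<open>Y\<close> of the kernel of a one-form \<open>\<theta>\<close>, differentiating \<open>\<theta>(Y) = 0\<close> along \<open>Z\<close> and
  \<open>\<theta>(Z) = 0\<close> along \<open>Y\<close> gives \<open>\<theta>([Z, Y]) = - d\<theta>(Z, Y)\<close>. So the kernel of a closed form, that is of one
  with a symmetric derivative \<open>\<theta>'\<close>, is involutive. Here \<open>\<theta>\<close> is a real one-form with values in a
  complexification, extended complex linearly, and this argument is carried out for the complex
  bilinear extension of the bracket.
\<close>
lemma involutive_kernel_closed_form: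
  fixes \<theta> :: "'b::euclidean_space \<Rightarrow> 'b \<Rightarrow> 'c::real_normed_vector \<times> 'c"
  assumes lin: "\<And>q. q \<in> X \<Longrightarrow> linear (\<theta> q)" and bil: "\<And>q. q \<in> X \<Longrightarrow> bilinear (\<theta>' q)"
    and der: "\<And>q v. q \<in> X \<Longrightarrow> ((\<lambda>q. \<theta> q v) has_derivative (\<lambda>h. \<theta>' q h v)) (at q)"
    and sym: "\<And>q u v. q \<in> X \<Longrightarrow> \<theta>' q u v = \<theta>' q v u"
    and P: "\<And>q z. q \<in> X \<Longrightarrow> z \<in> P q \<longleftrightarrow> \<theta> q (fst z) + cscale \<i> (\<theta> q (snd z)) = 0"
  shows "involutive X P"
  unfolding involutive_def
proof (intro allI impI ballI)
  fix W Z Y q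
  assume W: "open W" "W \<subseteq> X" and Z: "smooth_section W P Z" and Y: "smooth_section W P Y" and q: "q \<in> W"
  have qX: "q \<in> X"
    using W q by blast
  define Z1 where "Z1 = frechet_derivative (fst \<circ> Z) (at q)"
  define Z2 where "Z2 = frechet_derivative (snd \<circ> Z) (at q)"
  define Y1 where "Y1 = frechet_derivative (fst \<circ> Y) (at q)"
  define Y2 where "Y2 = frechet_derivative (snd \<circ> Y) (at q)"
  have E: "\<theta>' q h (fst (V q)) + \<theta> q (frechet_derivative (fst \<circ> V) (at q) h) +
      cscale \<i> (\<theta>' q h (snd (V q)) + \<theta> q (frechet_derivative (snd \<circ> V) (at q) h)) = 0"
    if V: "smooth_section W P V" for V h
  proof -
    have "(V has_derivative frechet_derivative V (at q)) (at q)"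
      using V q unfolding smooth_section_def by (intro smooth_on_has_derivative[of W]) auto
    then have V1: "((fst \<circ> V) has_derivative (\<lambda>h. fst (frechet_derivative V (at q) h))) (at q)"
      and V2: "((snd \<circ> V) has_derivative (\<lambda>h. snd (frechet_derivative V (at q) h))) (at q)"
      unfolding o_def by (rule has_derivative_fst, rule has_derivative_snd)
    have along: "((\<lambda>q. \<theta> q (U q)) has_derivative (\<lambda>h. \<theta>' q h (U q) + \<theta> q (U' h))) (at q)"
      if "(U has_derivative U') (at q)" for U U'
      using W lin
      by (intro has_derivative_one_form_along[where \<theta> = \<theta> and \<theta>' = \<theta>', OF W(1) q _ bil[OF qX] der[OF qX] that])
        blast
    have J: "bounded_linear (cscale \<i> :: 'c \<times> 'c \<Rightarrow> _)"
      unfolding cscale_ii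
      by (intro bounded_linear_Pair bounded_linear_minus bounded_linear_fst bounded_linear_snd)
    have "((\<lambda>q. \<theta> q ((fst \<circ> V) q) + cscale \<i> (\<theta> q ((snd \<circ> V) q))) has_derivative
      (\<lambda>h. \<theta>' q h ((fst \<circ> V) q) + \<theta> q (fst (frechet_derivative V (at q) h)) +
        cscale \<i> (\<theta>' q h ((snd \<circ> V) q) + \<theta> q (snd (frechet_derivative V (at q) h))))) (at q)"
      by (intro has_derivative_add bounded_linear.has_derivative[OF J] along[OF V1] along[OF V2])
    moreover have "((\<lambda>q. \<theta> q ((fst \<circ> V) q) + cscale \<i> (\<theta> q ((snd \<circ> V) q))) has_derivative (\<lambda>_. 0)) (at q)"
    proof (rule has_derivative_transform_within_open[OF has_derivative_const W(1) q])
      fix q'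
      assume q': "q' \<in> W"
      then have "V q' \<in> P q'" "q' \<in> X"
        using V W(2) unfolding smooth_section_def by auto
      then show "0 = \<theta> q' ((fst \<circ> V) q') + cscale \<i> (\<theta> q' ((snd \<circ> V) q'))"
        using P by simp
    qed
    ultimately have "(\<lambda>h. \<theta>' q h ((fst \<circ> V) q) + \<theta> q (fst (frechet_derivative V (at q) h)) +
        cscale \<i> (\<theta>' q h ((snd \<circ> V) q) + \<theta> q (snd (frechet_derivative V (at q) h)))) = (\<lambda>_. 0)"
      by (rule has_derivative_unique)
    from fun_cong[OF this, of h] show ?thesis
      unfolding frechet_derivative_at[OF V1, symmetric] frechet_derivative_at[OF V2, symmetric] by simp
  qed
  note linq = linear_add[OF lin[OF qX]] linear_diff[OF lin[OF qX]]
  have "\<theta> q (fst (clie_bracket Z Y q)) + cscale \<i> (\<theta> q (snd (clie_bracket Z Y q))) =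
      (\<theta>' q (fst (Z q)) (fst (Y q)) + \<theta> q (Y1 (fst (Z q))) +
        cscale \<i> (\<theta>' q (fst (Z q)) (snd (Y q)) + \<theta> q (Y2 (fst (Z q))))) +
      cscale \<i> (\<theta>' q (snd (Z q)) (fst (Y q)) + \<theta> q (Y1 (snd (Z q))) +
        cscale \<i> (\<theta>' q (snd (Z q)) (snd (Y q)) + \<theta> q (Y2 (snd (Z q))))) -
      (\<theta>' q (fst (Y q)) (fst (Z q)) + \<theta> q (Z1 (fst (Y q))) +
        cscale \<i> (\<theta>' q (fst (Y q)) (snd (Z q)) + \<theta> q (Z2 (fst (Y q))))) -
      cscale \<i> (\<theta>' q (snd (Y q)) (fst (Z q)) + \<theta> q (Z1 (snd (Y q))) +
        cscale \<i> (\<theta>' q (snd (Y q)) (snd (Z q)) + \<theta> q (Z2 (snd (Y q)))))"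
    unfolding sym[OF qX, of "fst (Y q)"] sym[OF qX, of "snd (Y q)"]
    by (simp add: clie_bracket_def lie_bracket_def Z1_def[symmetric] Z2_def[symmetric]
        Y1_def[symmetric] Y2_def[symmetric] linq prod_eq_iff cscale_ii)
  also have "\<dots> = 0"
    unfolding Y1_def Y2_def Z1_def Z2_def E[OF Y] E[OF Z] by (simp add: cscale_ii)
  finally show "clie_bracket Z Y q \<in> P q"
    using P[OF qX] by simp
qed

text \<open>
  A frame is given here as a real linear parametrization \<open>S\<close> by a Euclidean space, whose complex
  linear extension is injective with image \<open>P\<close>; the images of the standard basis are the frame.
\<close>
lemma complex_subbundle_frame:
  fixes S :: "'b::euclidean_space \<Rightarrow> 'e::euclidean_space \<Rightarrow> 'b \<times> 'b"
  assumes X: "open X" and smooth: "\<And>e. smooth_on X (\<lambda>q. S q e)"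
    and lin: "\<And>q. q \<in> X \<Longrightarrow> linear (S q)"
    and inj: "\<And>q c d. q \<in> X \<Longrightarrow> S q c + cscale \<i> (S q d) = 0 \<Longrightarrow> c = 0 \<and> d = 0"
    and P: "\<And>q. q \<in> X \<Longrightarrow> P q = {S q c + cscale \<i> (S q d) | c d. True}"
  shows "complex_subbundle X DIM('e) P"
proof -
  obtain h :: "nat \<Rightarrow> 'e" where h: "bij_betw h {..<DIM('e)} Basis"
    using ex_bij_betw_nat_finite[OF finite_Basis] unfolding atLeast0LessThan by blast
  have fibre: "inj_on (\<lambda>i. S q (h i)) {..<DIM('e)} \<and>
      cplx.independent ((\<lambda>i. S q (h i)) ` {..<DIM('e)}) \<and>
      cplx.span ((\<lambda>i. S q (h i)) ` {..<DIM('e)}) = P q" if q: "q \<in> X" for q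
  proof -
    have injS: "inj_on (S q) Basis"
    proof (rule inj_onI)
      fix e e'
      assume "S q e = S q e'"
      then have "S q (e - e') + cscale \<i> (S q 0) = 0"
        by (simp add: linear_diff[OF lin[OF q]] linear_0[OF lin[OF q]] cscale_ii prod_eq_iff)
      then show "e = e'"
        using inj[OF q, of "e - e'" 0] by simp
    qed
    have img: "(\<lambda>i. S q (h i)) ` {..<DIM('e)} = S q ` Basis"
      using h by (metis bij_betw_imp_surj_on image_image)
    have comb: "(\<Sum>v\<in>S q ` Basis. cscale (u v) v) =
        S q (\<Sum>e\<in>Basis. Re (u (S q e)) *\<^sub>R e) + cscale \<i> (S q (\<Sum>e\<in>Basis. Im (u (S q e)) *\<^sub>R e))" for u
      by (simp add: sum.reindex[OF injS] linear_sum[OF lin[OF q]] linear_scale[OF lin[OF q]]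
          prod_eq_iff cscale_ii cscale_def fst_sum snd_sum sum.distrib sum_subtractf sum_negf)
    have indep: "cplx.independent (S q ` Basis)"
    proof
      assume "cplx.dependent (S q ` Basis)"
      then obtain u v where u: "v \<in> S q ` Basis" "u v \<noteq> 0" "(\<Sum>v\<in>S q ` Basis. cscale (u v) v) = 0"
        unfolding cplx.dependent_finite[OF finite_imageI[OF finite_Basis]] by blast
      then obtain e where e: "e \<in> Basis" "v = S q e"
        by blast
      have "(\<Sum>e\<in>Basis. Re (u (S q e)) *\<^sub>R e) = 0" "(\<Sum>e\<in>Basis. Im (u (S q e)) *\<^sub>R e) = 0"
        using inj[OF q] u(3) unfolding comb by blast+
      then have "(\<Sum>e\<in>Basis. Re (u (S q e)) *\<^sub>R e) \<bullet> e = 0" "(\<Sum>e\<in>Basis. Im (u (S q e)) *\<^sub>R e) \<bullet> e = 0"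
        by simp_all
      then have "Re (u v) = 0" "Im (u v) = 0"
        using e by (simp_all add: inner_sum_left_Basis)
      then show False
        using u(2) by (simp add: complex_eq_iff)
    qed
    have "cplx.span (S q ` Basis) = range (\<lambda>u. \<Sum>v\<in>S q ` Basis. cscale (u v) v)"
      by (rule cplx.span_finite) simp
    also have "\<dots> = P q"
    proof (intro equalityI subsetI)
      fix z
      assume "z \<in> range (\<lambda>u. \<Sum>v\<in>S q ` Basis. cscale (u v) v)"
      then show "z \<in> P q"
        unfolding comb P[OF q] by blast
    next
      fix z
      assume "z \<in> P q"
      then obtain c d where z: "z = S q c + cscale \<i> (S q d)"
        unfolding P[OF q] by blast
      define u where "u v = Complex (c \<bullet> the_inv_into Basis (S q) v) (d \<bullet> the_inv_into Basis (S q) v)" for v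
      have "u (S q e) = Complex (c \<bullet> e) (d \<bullet> e)" if "e \<in> Basis" for e
        using that by (simp add: u_def the_inv_into_f_f[OF injS])
      then have "(\<Sum>v\<in>S q ` Basis. cscale (u v) v) = z"
        unfolding comb z by (simp add: euclidean_representation)
      then show "z \<in> range (\<lambda>u. \<Sum>v\<in>S q ` Basis. cscale (u v) v)"
        by blast
    qed
    finally have span: "cplx.span (S q ` Basis) = P q" .
    have "inj_on (\<lambda>i. S q (h i)) {..<DIM('e)}"
      using comp_inj_on[of h "{..<DIM('e)}" "S q"] h injS by (simp add: bij_betw_def o_def)
    then show ?thesis
      unfolding img using indep span by blast
  qed
  show ?thesis
    unfolding complex_subbundle_def
  proof
    fix p
    assume p: "p \<in> X"
    show "\<exists>W s. open W \<and> p \<in> W \<and> W \<subseteq> X \<and> (\<forall>i<DIM('e). smooth_on W (s i)) \<and>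
        (\<forall>q\<in>W. inj_on (\<lambda>i. s i q) {..<DIM('e)} \<and>
           cplx.independent ((\<lambda>i. s i q) ` {..<DIM('e)}) \<and>
           cplx.span ((\<lambda>i. s i q) ` {..<DIM('e)}) = P q)"
      by (rule exI[of _ X], rule exI[of _ "\<lambda>i q. S q (h i)"])
        (use X p smooth fibre in blast)
  qed
qed

section \<open>The complexified geodesics\<close>

text \<open>
  Along a geodesic that starts at \<open>p = (r, b)\<close> with velocity \<open>v\<close>, put \<open>x = v\<^sub>0 / r\<close>; then the first
  coordinate is \<open>r (1 + a x t)\<^bsup>1/a\<^esup>\<close>, to be read as \<open>r exp (x t)\<close> for \<open>a = 0\<close>. It continues analytically to
  the time \<open>t = -\<i>\<close>, where it is \<open>r phi(x)\<close>, and because the geodesic runs on a straight line, its position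
  is then \<open>p + psi(x) v\<close> with \<open>psi(x) = (phi(x) - 1) / x\<close>. The singularity at \<open>x = 0\<close> is removable, so
  smoothness of \<open>psi\<close> on the real line follows from holomorphy near it. The strip is a neighbourhood of
  the real line on which \<open>1 - \<i> a z\<close> has positive real part, so that the logarithm is holomorphic.
\<close>
definition strip :: "real \<Rightarrow> complex set" where
  "strip a = {z. 1 + a * Im z > 0}"

definition phi :: "real \<Rightarrow> complex \<Rightarrow> complex" where
  "phi a z = (if a = 0 then exp (- \<i> * z) else exp (Ln (1 - \<i> * of_real a * z) / of_real a))"

definition psi :: "real \<Rightarrow> complex \<Rightarrow> complex" where
  "psi a z = (if z = 0 then deriv (phi a) 0 else (phi a z - 1) / z)"

lemma open_strip: "open (strip a)"
  unfolding strip_def by (intro open_Collect_less continuous_intros)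

lemma of_real_in_strip: "complex_of_real x \<in> strip a"
  by (simp add: strip_def)

lemma phi_has_field_derivative:
  assumes "z \<in> strip a"
  shows "(phi a has_field_derivative - \<i> * phi a z / (1 - \<i> * of_real a * z)) (at z)"
proof (cases "a = 0")
  case True
  then show ?thesis
    unfolding phi_def by (auto intro!: derivative_eq_intros)
next
  case False
  have "Re (1 - \<i> * of_real a * z) > 0"
    using assms by (simp add: strip_def)
  then have *: "1 - \<i> * of_real a * z \<notin> \<real>\<^sub>\<le>\<^sub>0"
    using complex_nonpos_Reals_iff by auto
  have "((\<lambda>z. 1 - \<i> * of_real a * z) has_field_derivative - (\<i> * of_real a)) (at z)"
    by (auto intro!: derivative_eq_intros)
  from DERIV_chain2[where f = Ln, OF has_field_derivative_Ln[OF *] this]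
  have "((\<lambda>z. Ln (1 - \<i> * of_real a * z) / of_real a) has_field_derivative
      inverse (1 - \<i> * of_real a * z) * - (\<i> * of_real a) / of_real a) (at z)"
    by (rule DERIV_cdivide)
  from DERIV_chain2[where f = exp, OF DERIV_exp this]
  have "(phi a has_field_derivative
      phi a z * (inverse (1 - \<i> * of_real a * z) * - (\<i> * of_real a) / of_real a)) (at z)"
    using False by (simp only: phi_def[abs_def] if_False)
  then show ?thesis
    using False by (simp, simp add: divide_inverse mult_ac)
qed

lemma phi_nonzero: "phi a z \<noteq> 0"
  by (simp add: phi_def)

lemma phi_0: "phi a 0 = 1"
  by (simp add: phi_def)

lemma phi_eq_psi: "phi a z = 1 + z * psi a z"
  by (simp add: psi_def phi_0)

lemma psi_holomorphic: "psi a holomorphic_on strip a"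
proof -
  have "phi a holomorphic_on strip a"
    using phi_has_field_derivative holomorphic_on_open[OF open_strip] by blast
  then show ?thesis
    using pole_lemma_open[OF _ open_strip, of "phi a" a 0]
    unfolding psi_def[abs_def] phi_0 diff_0_right by blast
qed

text \<open>
  This is the differential equation \<open>(\<i> + a x) phi'(x) = phi(x)\<close> on the real line, rewritten with
  \<open>phi(x) = 1 + x psi(x)\<close>.
\<close>
lemma psi_ode:
  "(\<i> + of_real (a * x)) * (psi a (of_real x) + of_real x * deriv (psi a) (of_real x)) =
    1 + of_real x * psi a (of_real x)"
proof -
  let ?z = "complex_of_real x"
  have "(psi a has_field_derivative deriv (psi a) ?z) (at ?z)"
    by (rule holomorphic_derivI[OF psi_holomorphic open_strip of_real_in_strip])
  then have "((\<lambda>z. 1 + z * psi a z) has_field_derivative (psi a ?z + ?z * deriv (psi a) ?z)) (at ?z)"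
    by (auto intro!: derivative_eq_intros)
  then have "(phi a has_field_derivative (psi a ?z + ?z * deriv (psi a) ?z)) (at ?z)"
    by (simp add: phi_eq_psi[symmetric])
  then have "psi a ?z + ?z * deriv (psi a) ?z = - \<i> * phi a ?z / (1 - \<i> * of_real a * ?z)"
    by (rule DERIV_unique[OF _ phi_has_field_derivative[OF of_real_in_strip]])
  moreover have "1 - \<i> * of_real a * ?z \<noteq> 0" "\<i> + of_real (a * x) = \<i> * (1 - \<i> * of_real a * ?z)"
    by (auto simp: complex_eq_iff)
  ultimately show ?thesis
    by (simp add: phi_eq_psi[symmetric])
qed

lemma smooth_psi:
  "smooth_on UNIV (\<lambda>x. psi a (of_real x))" "smooth_on UNIV (\<lambda>x. deriv (psi a) (of_real x))"
  "smooth_on UNIV (\<lambda>x. deriv (deriv (psi a)) (of_real x))"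
proof -
  have *: "range complex_of_real \<subseteq> strip a"
    using of_real_in_strip by blast
  show "smooth_on UNIV (\<lambda>x. psi a (of_real x))" "smooth_on UNIV (\<lambda>x. deriv (psi a) (of_real x))"
    "smooth_on UNIV (\<lambda>x. deriv (deriv (psi a)) (of_real x))"
    by (rule smooth_on_holomorphic[OF _ open_strip *];
        intro holomorphic_deriv psi_holomorphic open_strip)+
qed

section \<open>The polarization on the tangent bundle of the group\<close>

text \<open>
  Points of the tangent bundle are written \<open>q = (p, v)\<close>. The slope is the logarithmic derivative \<open>v\<^sub>0 / r\<close>
  of the first coordinate along a curve with velocity \<open>v\<close>.
\<close>
definition slope :: "'n::finite acoord \<times> 'n acoord \<Rightarrow> real" where
  "slope q = fst (snd q) / fst (fst q)"

definition slope_deriv :: "'n::finite acoord \<times> 'n acoord \<Rightarrow> 'n acoord \<times> 'n acoord \<Rightarrow> real" where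
  "slope_deriv q h = (fst (snd h) - slope q * fst (fst h)) / fst (fst q)"

definition slope_deriv2 ::
  "'n::finite acoord \<times> 'n acoord \<Rightarrow> 'n acoord \<times> 'n acoord \<Rightarrow> 'n acoord \<times> 'n acoord \<Rightarrow> real" where
  "slope_deriv2 q h k = - (slope_deriv q h * fst (fst k) + slope_deriv q k * fst (fst h)) / fst (fst q)"

lemma slope_has_derivative:
  "fst (fst q) \<noteq> 0 \<Longrightarrow> (slope has_derivative slope_deriv q) (at q)"
  unfolding slope_def[abs_def] slope_deriv_def[abs_def]
  by (auto intro!: derivative_eq_intros simp: field_simps)

lemma slope_deriv_has_derivative:
  assumes "fst (fst q) \<noteq> 0"
  shows "((\<lambda>q. slope_deriv q k) has_derivative (\<lambda>h. slope_deriv2 q h k)) (at q)"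
proof -
  have num: "((\<lambda>q. fst (snd k) - slope q * fst (fst k)) has_derivative
      (\<lambda>h. 0 - slope_deriv q h * fst (fst k))) (at q)"
    by (intro has_derivative_diff has_derivative_const has_derivative_mult_left slope_has_derivative assms)
  have den: "((\<lambda>q. fst (fst q)) has_derivative (\<lambda>h. fst (fst h))) (at q)"
    by (intro has_derivative_fst has_derivative_ident)
  show ?thesis
    unfolding slope_deriv_def
    by (rule has_derivative_eq_rhs[OF has_derivative_divide'[OF num den assms]])
      (use assms in \<open>simp add: slope_deriv_def slope_deriv2_def fun_eq_iff field_simps\<close>)
qed

lemma linear_slope_deriv:
  "slope_deriv q (h + k) = slope_deriv q h + slope_deriv q k"
  "slope_deriv q (c *\<^sub>R h) = c * slope_deriv q h"
  by (simp_all add: slope_deriv_def add_divide_distrib diff_divide_distrib ring_distribs)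

lemma linear_slope_deriv2:
  "slope_deriv2 q (h + h') k = slope_deriv2 q h k + slope_deriv2 q h' k"
  "slope_deriv2 q k (h + h') = slope_deriv2 q k h + slope_deriv2 q k h'"
  "slope_deriv2 q (c *\<^sub>R h) k = c * slope_deriv2 q h k"
  "slope_deriv2 q k (c *\<^sub>R h) = c * slope_deriv2 q k h"
  by (simp_all add: slope_deriv2_def linear_slope_deriv add_divide_distrib diff_divide_distrib
      ring_distribs ac_simps)

text \<open>The differential of \<open>q \<mapsto> f(slope q) v\<close>, and below it the second derivative of this map.\<close>
definition exact_form :: "(real \<Rightarrow> real) \<Rightarrow> (real \<Rightarrow> real) \<Rightarrow>
    'n::finite acoord \<times> 'n acoord \<Rightarrow> 'n acoord \<times> 'n acoord \<Rightarrow> 'n acoord" where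
  "exact_form f f' q h = f (slope q) *\<^sub>R snd h + (slope_deriv q h * f' (slope q)) *\<^sub>R snd q"

definition exact_form_deriv :: "(real \<Rightarrow> real) \<Rightarrow> (real \<Rightarrow> real) \<Rightarrow>
    'n::finite acoord \<times> 'n acoord \<Rightarrow> 'n acoord \<times> 'n acoord \<Rightarrow> 'n acoord \<times> 'n acoord \<Rightarrow> 'n acoord" where
  "exact_form_deriv f' f'' q h k =
    (slope_deriv q h * f' (slope q)) *\<^sub>R snd k + (slope_deriv q k * f' (slope q)) *\<^sub>R snd h +
    (slope_deriv2 q h k * f' (slope q) + slope_deriv q k * (slope_deriv q h * f'' (slope q))) *\<^sub>R snd q"

lemma linear_exact_form: "linear (exact_form f f' q)"
  by (rule linearI) (simp_all add: exact_form_def linear_slope_deriv algebra_simps)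

lemma exact_form_has_derivative:
  assumes "fst (fst q) \<noteq> 0"
    and f: "\<And>x. (f has_field_derivative f' x) (at x)" "\<And>x. (f' has_field_derivative f'' x) (at x)"
  shows "((\<lambda>q. exact_form f f' q k) has_derivative (\<lambda>h. exact_form_deriv f' f'' q h k)) (at q)"
proof -
  have comp: "((\<lambda>q. g (slope q)) has_derivative (\<lambda>h. g' * slope_deriv q h)) (at q)"
    if "(g has_field_derivative g') (at (slope q))" for g g'
    using has_derivative_compose[OF slope_has_derivative[OF assms(1)]] that
    unfolding has_field_derivative_def by blast
  have "((\<lambda>q. exact_form f f' q k) has_derivative
      (\<lambda>h. (f' (slope q) * slope_deriv q h) *\<^sub>R snd k +
        ((slope_deriv q k * f' (slope q)) *\<^sub>R snd h +
        (slope_deriv q k * (f'' (slope q) * slope_deriv q h) + slope_deriv2 q h k * f' (slope q)) *\<^sub>R snd q)))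
      (at q)"
    unfolding exact_form_def
    by (intro has_derivative_add has_derivative_scaleR_left comp f has_derivative_scaleR
        has_derivative_mult slope_deriv_has_derivative assms(1) has_derivative_snd has_derivative_ident)
  then show ?thesis
    by (rule has_derivative_eq_rhs) (auto simp: exact_form_deriv_def algebra_simps)
qed

lemma bilinear_exact_form_deriv: "bilinear (exact_form_deriv f' f'' q)"
  unfolding bilinear_def
  by (intro conjI allI linearI)
    (simp_all add: exact_form_deriv_def linear_slope_deriv linear_slope_deriv2 algebra_simps)

lemma exact_form_deriv_commute: "exact_form_deriv f' f'' q h k = exact_form_deriv f' f'' q k h"
  by (simp add: exact_form_deriv_def slope_deriv2_def algebra_simps)

definition psi_re :: "real \<Rightarrow> real \<Rightarrow> real" where "psi_re a x = Re (psi a (of_real x))"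
definition psi_im :: "real \<Rightarrow> real \<Rightarrow> real" where "psi_im a x = Im (psi a (of_real x))"
definition psi_re' :: "real \<Rightarrow> real \<Rightarrow> real" where "psi_re' a x = Re (deriv (psi a) (of_real x))"
definition psi_im' :: "real \<Rightarrow> real \<Rightarrow> real" where "psi_im' a x = Im (deriv (psi a) (of_real x))"

lemma Re_Im_has_real_derivative:
  assumes "h holomorphic_on strip a"
  shows "((\<lambda>x. Re (h (of_real x))) has_field_derivative Re (deriv h (of_real x))) (at x)"
    and "((\<lambda>x. Im (h (of_real x))) has_field_derivative Im (deriv h (of_real x))) (at x)"
proof -
  have "(h has_field_derivative deriv h (of_real x)) (at (of_real x))"
    by (rule holomorphic_derivI[OF assms open_strip of_real_in_strip])
  then have "((\<lambda>x. h (of_real x)) has_vector_derivative deriv h (of_real x)) (at x)"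
    using has_vector_derivative_real_field by blast
  then show "((\<lambda>x. Re (h (of_real x))) has_field_derivative Re (deriv h (of_real x))) (at x)"
    and "((\<lambda>x. Im (h (of_real x))) has_field_derivative Im (deriv h (of_real x))) (at x)"
    unfolding has_real_derivative_iff_has_vector_derivative
    by (rule bounded_linear.has_vector_derivative[OF bounded_linear_Re],
        rule bounded_linear.has_vector_derivative[OF bounded_linear_Im])
qed

lemma psi_has_derivatives:
  "(psi_re a has_field_derivative psi_re' a x) (at x)"
  "(psi_im a has_field_derivative psi_im' a x) (at x)"
  "(psi_re' a has_field_derivative Re (deriv (deriv (psi a)) (of_real x))) (at x)"
  "(psi_im' a has_field_derivative Im (deriv (deriv (psi a)) (of_real x))) (at x)"
  unfolding psi_re_def[abs_def] psi_im_def[abs_def] psi_re'_def[abs_def] psi_im'_def[abs_def]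
  by (intro Re_Im_has_real_derivative[where a = a] psi_holomorphic
      holomorphic_deriv[OF psi_holomorphic open_strip])+

lemma psi_ode_real:
  "a * x * (psi_re a x + x * psi_re' a x) - (psi_im a x + x * psi_im' a x) = 1 + x * psi_re a x"
  "(psi_re a x + x * psi_re' a x) + a * x * (psi_im a x + x * psi_im' a x) = x * psi_im a x"
  using psi_ode[of a x]
  by (simp_all add: complex_eq_iff psi_re_def psi_im_def psi_re'_def psi_im'_def algebra_simps)

lemma psi_nonzero: "(psi_re a x + x * psi_re' a x)\<^sup>2 + (psi_im a x + x * psi_im' a x)\<^sup>2 \<noteq> 0"
proof
  assume "(psi_re a x + x * psi_re' a x)\<^sup>2 + (psi_im a x + x * psi_im' a x)\<^sup>2 = 0"
  then have "psi_re a x + x * psi_re' a x = 0" "psi_im a x + x * psi_im' a x = 0"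
    by (simp_all add: sum_power2_eq_zero_iff)
  then have "1 + x * psi_re a x = 0" "x * psi_im a x = 0"
    using psi_ode_real[of a x] by simp_all
  then have "phi a (of_real x) = 0"
    by (simp add: phi_eq_psi complex_eq_iff psi_re_def psi_im_def)
  then show False
    using phi_nonzero by blast
qed

text \<open>
  This is the differential of \<open>q = (p, v) \<mapsto> p + psi(slope q) v\<close>, the position at the time \<open>-\<i>\<close> of the
  geodesic with initial velocity \<open>v\<close>, split into real and imaginary part. The polarization is the kernel
  of its complex linear extension. The map sends \<open>\<Omega>(t + \<i> s)\<close> to \<open>\<gamma>(t - \<i> s)\<close>; this depends
  antiholomorphically on \<open>t + \<i> s\<close>, which is why the kernel contains the images of the \<open>(1, 0)\<close>-vectors.
\<close>
definition theta :: "real \<Rightarrow> 'n::finite acoord \<times> 'n acoord \<Rightarrow> 'n acoord \<times> 'n acoord \<Rightarrow> 'n acoord \<times> 'n acoord" where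
  "theta a q h = (fst h + exact_form (psi_re a) (psi_re' a) q h, exact_form (psi_im a) (psi_im' a) q h)"

definition pol :: "real \<Rightarrow> 'n::finite acoord \<times> 'n acoord \<Rightarrow>
    (('n acoord \<times> 'n acoord) \<times> ('n acoord \<times> 'n acoord)) set" where
  "pol a q = {z. theta a q (fst z) + cscale \<i> (theta a q (snd z)) = 0}"

lemma tangent_half_space: "q \<in> tangent_bundle half_space \<longleftrightarrow> fst (fst q) > 0"
  by (cases q) (simp add: tangent_bundle_def half_space_def)

lemma involutive_pol: "involutive (tangent_bundle half_space) (pol a :: 'n::finite acoord \<times> 'n acoord \<Rightarrow> _)"
proof (rule involutive_kernel_closed_form)
  fix q v :: "'n acoord \<times> 'n acoord"
  assume "q \<in> tangent_bundle half_space"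
  then have q: "fst (fst q) \<noteq> 0"
    by (simp add: tangent_half_space)
  let ?\<theta>' = "\<lambda>q h k. (exact_form_deriv (psi_re' a) (\<lambda>x. Re (deriv (deriv (psi a)) (of_real x))) q h k,
    exact_form_deriv (psi_im' a) (\<lambda>x. Im (deriv (deriv (psi a)) (of_real x))) q h k)"
  show "linear (theta a q)"
    by (rule linearI) (simp_all add: theta_def linear_add[OF linear_exact_form]
        linear_scale[OF linear_exact_form] scaleR_add_right)
  show "bilinear (?\<theta>' q)"
    unfolding bilinear_def
    by (intro conjI allI linearI)
      (simp_all add: bilinear_ladd[OF bilinear_exact_form_deriv] bilinear_radd[OF bilinear_exact_form_deriv]
        bilinear_lmul[OF bilinear_exact_form_deriv] bilinear_rmul[OF bilinear_exact_form_deriv])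
  have "((\<lambda>q. fst v + exact_form (psi_re a) (psi_re' a) q v) has_derivative
      (\<lambda>h. 0 + exact_form_deriv (psi_re' a) (\<lambda>x. Re (deriv (deriv (psi a)) (of_real x))) q h v)) (at q)"
    by (intro has_derivative_add has_derivative_const exact_form_has_derivative q psi_has_derivatives)
  then show "((\<lambda>q. theta a q v) has_derivative (\<lambda>h. ?\<theta>' q h v)) (at q)"
    unfolding theta_def
    by (intro has_derivative_Pair exact_form_has_derivative q psi_has_derivatives) simp
  show "?\<theta>' q u v = ?\<theta>' q v u" for u
    by (simp add: exact_form_deriv_commute[of _ _ _ u])
  show "z \<in> pol a q \<longleftrightarrow> theta a q (fst z) + cscale \<i> (theta a q (snd z)) = 0" for z
    by (simp add: pol_def)
qed

text \<open>
  Real and imaginary part of \<open>psi'(x) (\<i> + a x) / r\<close>, which multiplies \<open>v\<^sub>v\<close> in the \<open>b\<close>-component of a vector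
  of the polarization once the \<open>v\<^sub>0\<close>-component has been eliminated.
\<close>
definition mix_re :: "real \<Rightarrow> 'n::finite acoord \<times> 'n acoord \<Rightarrow> real" where
  "mix_re a q = (a * slope q * psi_re' a (slope q) - psi_im' a (slope q)) / fst (fst q)"

definition mix_im :: "real \<Rightarrow> 'n::finite acoord \<times> 'n acoord \<Rightarrow> real" where
  "mix_im a q = (psi_re' a (slope q) + a * slope q * psi_im' a (slope q)) / fst (fst q)"

text \<open>
  In complex notation, with \<open>\<psi> = f + \<i> g\<close> and \<open>\<phi>' = (f + x f') + \<i> (g + x g')\<close>, the left hand side is the
  single equation \<open>(1 - x\<^sup>2 \<psi>') \<alpha> + \<phi>' \<rho> = 0\<close>. The differential equation turns the coefficient of \<open>\<alpha>\<close> into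
  \<open>(\<i> + (a - 1) x) \<phi>'\<close>, so that the non-zero factor \<open>\<phi>'\<close> can be cancelled.
\<close>
lemma kernel_scalar_iff:
  fixes a x f f' g g' \<alpha>1 \<alpha>2 \<rho>1 \<rho>2 :: real
  assumes ode: "a * x * (f + x * f') - (g + x * g') = 1 + x * f" "(f + x * f') + a * x * (g + x * g') = x * g"
    and nz: "(f + x * f')\<^sup>2 + (g + x * g')\<^sup>2 \<noteq> 0"
  shows "\<alpha>1 + f * \<rho>1 + (\<rho>1 - x * \<alpha>1) * f' * x - g * \<rho>2 - (\<rho>2 - x * \<alpha>2) * g' * x = 0 \<and>
      g * \<rho>1 + (\<rho>1 - x * \<alpha>1) * g' * x + \<alpha>2 + f * \<rho>2 + (\<rho>2 - x * \<alpha>2) * f' * x = 0 \<longleftrightarrow>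
    \<rho>1 = \<alpha>2 - (a - 1) * x * \<alpha>1 \<and> \<rho>2 = - \<alpha>1 - (a - 1) * x * \<alpha>2"
proof -
  define F where "F = f + x * f'"
  define G where "G = g + x * g'"
  define s where "s = \<rho>1 - \<alpha>2 + (a - 1) * x * \<alpha>1"
  define t where "t = \<rho>2 + \<alpha>1 + (a - 1) * x * \<alpha>2"
  have 1: "\<alpha>1 + f * \<rho>1 + (\<rho>1 - x * \<alpha>1) * f' * x - g * \<rho>2 - (\<rho>2 - x * \<alpha>2) * g' * x = F * s - G * t"
    using ode unfolding F_def G_def s_def t_def by algebra
  have 2: "g * \<rho>1 + (\<rho>1 - x * \<alpha>1) * g' * x + \<alpha>2 + f * \<rho>2 + (\<rho>2 - x * \<alpha>2) * f' * x = G * s + F * t"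
    using ode unfolding F_def G_def s_def t_def by algebra
  have "s = 0 \<and> t = 0" if "F * s - G * t = 0" "G * s + F * t = 0"
  proof -
    have "(F\<^sup>2 + G\<^sup>2) * s = 0" "(F\<^sup>2 + G\<^sup>2) * t = 0"
      using that by algebra+
    then show ?thesis
      using nz unfolding F_def[symmetric] G_def[symmetric] mult_eq_0_iff by blast
  qed
  then have "F * s - G * t = 0 \<and> G * s + F * t = 0 \<longleftrightarrow> s = 0 \<and> t = 0"
    by auto
  then show ?thesis
    unfolding 1 2 by (auto simp: s_def t_def)
qed

text \<open>
  The equations of the polarization, solved for the \<open>v\<^sub>0\<close>- and the \<open>b\<close>-component. The other two components
  are free, so the rank is constant even at points where the map behind \<open>theta\<close> is not a local
  diffeomorphism.
\<close>

lemma pol_iff: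
  fixes q :: "'n::finite acoord \<times> 'n acoord"
  assumes "fst (fst q) > 0"
  shows "(((\<alpha>1, \<beta>1), (\<rho>1, \<upsilon>1)), ((\<alpha>2, \<beta>2), (\<rho>2, \<upsilon>2))) \<in> pol a q \<longleftrightarrow>
    \<rho>1 = \<alpha>2 - (a - 1) * slope q * \<alpha>1 \<and> \<rho>2 = - \<alpha>1 - (a - 1) * slope q * \<alpha>2 \<and>
    \<beta>1 = psi_im a (slope q) *\<^sub>R \<upsilon>2 - psi_re a (slope q) *\<^sub>R \<upsilon>1 +
      (\<alpha>1 * mix_re a q - \<alpha>2 * mix_im a q) *\<^sub>R snd (snd q) \<and>
    \<beta>2 = - psi_im a (slope q) *\<^sub>R \<upsilon>1 - psi_re a (slope q) *\<^sub>R \<upsilon>2 +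
      (\<alpha>1 * mix_im a q + \<alpha>2 * mix_re a q) *\<^sub>R snd (snd q)"
proof -
  define r x u f g f' g' where "r = fst (fst q)" and "x = slope q" and "u = snd (snd q)"
    and "f = psi_re a x" and "g = psi_im a x" and "f' = psi_re' a x" and "g' = psi_im' a x"
  have r: "r > 0"
    using assms by (simp add: r_def)
  have v0: "fst (snd q) = x * r"
    using r by (simp add: x_def slope_def r_def)
  define x1 x2 where "x1 = (\<rho>1 - x * \<alpha>1) / r" and "x2 = (\<rho>2 - x * \<alpha>2) / r"
  have x12: "(\<rho>1 - x * \<alpha>1) = x1 * r" "(\<rho>2 - x * \<alpha>2) = x2 * r"
    using r by (simp_all add: x1_def x2_def)
  have sd: "slope_deriv q ((\<alpha>1, \<beta>1), (\<rho>1, \<upsilon>1)) = x1" "slope_deriv q ((\<alpha>2, \<beta>2), (\<rho>2, \<upsilon>2)) = x2"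
    by (simp_all add: slope_deriv_def x1_def x2_def x_def r_def)
  have pol: "(((\<alpha>1, \<beta>1), (\<rho>1, \<upsilon>1)), ((\<alpha>2, \<beta>2), (\<rho>2, \<upsilon>2))) \<in> pol a q \<longleftrightarrow>
      (\<alpha>1 + f * \<rho>1 + (\<rho>1 - x * \<alpha>1) * f' * x - g * \<rho>2 - (\<rho>2 - x * \<alpha>2) * g' * x = 0 \<and>
      g * \<rho>1 + (\<rho>1 - x * \<alpha>1) * g' * x + \<alpha>2 + f * \<rho>2 + (\<rho>2 - x * \<alpha>2) * f' * x = 0) \<and>
      \<beta>1 + f *\<^sub>R \<upsilon>1 + (x1 * f') *\<^sub>R u - g *\<^sub>R \<upsilon>2 - (x2 * g') *\<^sub>R u = 0 \<and>
      g *\<^sub>R \<upsilon>1 + (x1 * g') *\<^sub>R u + \<beta>2 + f *\<^sub>R \<upsilon>2 + (x2 * f') *\<^sub>R u = 0"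
    unfolding pol_def theta_def exact_form_def cscale_ii x12
    by (simp add: prod_eq_iff x_def[symmetric] r_def[symmetric] u_def[symmetric] f_def[symmetric]
        g_def[symmetric] f'_def[symmetric] g'_def[symmetric] v0 sd algebra_simps) blast
  have scalar: "(\<alpha>1 + f * \<rho>1 + (\<rho>1 - x * \<alpha>1) * f' * x - g * \<rho>2 - (\<rho>2 - x * \<alpha>2) * g' * x = 0 \<and>
      g * \<rho>1 + (\<rho>1 - x * \<alpha>1) * g' * x + \<alpha>2 + f * \<rho>2 + (\<rho>2 - x * \<alpha>2) * f' * x = 0) \<longleftrightarrow>
      \<rho>1 = \<alpha>2 - (a - 1) * x * \<alpha>1 \<and> \<rho>2 = - \<alpha>1 - (a - 1) * x * \<alpha>2"
    using psi_ode_real[of a x] psi_nonzero[of a x]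
    unfolding f_def[symmetric] g_def[symmetric] f'_def[symmetric] g'_def[symmetric]
    by (rule kernel_scalar_iff)
  have mix: "x2 * g' - x1 * f' = \<alpha>1 * mix_re a q - \<alpha>2 * mix_im a q"
    "- (x1 * g' + x2 * f') = \<alpha>1 * mix_im a q + \<alpha>2 * mix_re a q"
    if "\<rho>1 = \<alpha>2 - (a - 1) * x * \<alpha>1" "\<rho>2 = - \<alpha>1 - (a - 1) * x * \<alpha>2"
    unfolding x1_def x2_def mix_re_def mix_im_def that x_def[symmetric] r_def[symmetric]
      f'_def[symmetric] g'_def[symmetric]
    using r by (simp_all add: field_simps)
  have vec: "\<beta>1 + f *\<^sub>R \<upsilon>1 + (x1 * f') *\<^sub>R u - g *\<^sub>R \<upsilon>2 - (x2 * g') *\<^sub>R u = 0 \<longleftrightarrow>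
      \<beta>1 = g *\<^sub>R \<upsilon>2 - f *\<^sub>R \<upsilon>1 + (x2 * g' - x1 * f') *\<^sub>R u"
    "g *\<^sub>R \<upsilon>1 + (x1 * g') *\<^sub>R u + \<beta>2 + f *\<^sub>R \<upsilon>2 + (x2 * f') *\<^sub>R u = 0 \<longleftrightarrow>
      \<beta>2 = - g *\<^sub>R \<upsilon>1 - f *\<^sub>R \<upsilon>2 + (- (x1 * g' + x2 * f')) *\<^sub>R u"
    by (auto simp: vec_eq_iff algebra_simps eq_neg_iff_add_eq_0)
  show ?thesis
    unfolding pol scalar vec
    unfolding x_def[symmetric] u_def[symmetric] f_def[symmetric] g_def[symmetric]
    using mix by auto
qed

text \<open>
  The solution of these equations whose free components, those of \<open>r\<close> and of \<open>v\<^sub>v\<close>, are the real vector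
  \<open>c\<close>.
\<close>
definition frame :: "real \<Rightarrow> 'n::finite acoord \<times> 'n acoord \<Rightarrow> 'n acoord \<Rightarrow>
    ('n acoord \<times> 'n acoord) \<times> ('n acoord \<times> 'n acoord)" where
  "frame a q c =
    (((fst c, (fst c * mix_re a q) *\<^sub>R snd (snd q) - psi_re a (slope q) *\<^sub>R snd c),
      (- ((a - 1) * slope q * fst c), snd c)),
     ((0, (fst c * mix_im a q) *\<^sub>R snd (snd q) - psi_im a (slope q) *\<^sub>R snd c),
      (- fst c, 0)))"

lemma open_tangent_half_space: "open (tangent_bundle half_space :: ('n::finite acoord \<times> 'n acoord) set)"
  unfolding tangent_bundle_def by (intro open_Times open_half_space open_UNIV)

lemma smooth_psi_slope:
  fixes X :: "('n::finite acoord \<times> 'n acoord) set"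
  defines "X \<equiv> tangent_bundle half_space"
  shows "smooth_on X (\<lambda>q. inverse (fst (fst q)))" "smooth_on X slope"
    "smooth_on X (\<lambda>q. psi_re a (slope q))" "smooth_on X (\<lambda>q. psi_im a (slope q))"
    "smooth_on X (\<lambda>q. psi_re' a (slope q))" "smooth_on X (\<lambda>q. psi_im' a (slope q))"
proof -
  have X: "open X"
    unfolding X_def by (rule open_tangent_half_space)
  note coord = smooth_on_linear[OF X bounded_linear_fst] smooth_on_linear[OF X bounded_linear_snd]
    smooth_on_id[OF X]
  have "smooth_on X (\<lambda>q. fst (fst q))"
    by (intro coord)
  then show inv: "smooth_on X (\<lambda>q. inverse (fst (fst q)))"
    by (rule smooth_on_inverse[OF X]) (simp add: X_def tangent_half_space)
  have "smooth_on X (\<lambda>q. fst (snd q) * inverse (fst (fst q)))"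
    by (intro smooth_on_bilinear[OF X bounded_bilinear_mult] inv coord)
  then show slope: "smooth_on X slope"
    by (simp add: slope_def[abs_def] divide_inverse)
  have comp: "smooth_on X (\<lambda>q. h (slope q))" if "smooth_on UNIV h" for h :: "real \<Rightarrow> complex"
    by (rule smooth_on_compose[OF X that slope]) simp
  show "smooth_on X (\<lambda>q. psi_re a (slope q))" "smooth_on X (\<lambda>q. psi_im a (slope q))"
    "smooth_on X (\<lambda>q. psi_re' a (slope q))" "smooth_on X (\<lambda>q. psi_im' a (slope q))"
    unfolding psi_re_def psi_im_def psi_re'_def psi_im'_def
    by (rule smooth_on_linear[OF X bounded_linear_Re] smooth_on_linear[OF X bounded_linear_Im];
        rule comp[OF smooth_psi(1)] comp[OF smooth_psi(2)])+
qed

lemma complex_subbundle_pol: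
  "complex_subbundle (tangent_bundle half_space) (DIM('n acoord)) (pol a :: 'n::finite acoord \<times> 'n acoord \<Rightarrow> _)"
proof (rule complex_subbundle_frame[where S = "frame a"])
  show X: "open (tangent_bundle half_space :: ('n acoord \<times> 'n acoord) set)"
    by (rule open_tangent_half_space)
  fix c :: "'n acoord"
  let ?X = "tangent_bundle half_space :: ('n acoord \<times> 'n acoord) set"
  note const = smooth_on_const[OF X]
  note mult = smooth_on_bilinear[OF X bounded_bilinear_mult]
  note scale = smooth_on_bilinear[OF X bounded_bilinear_scaleR]
  note minus = smooth_on_linear[OF X bounded_linear_minus[OF bounded_linear_ident]]
  have mix: "smooth_on ?X (mix_re a)" "smooth_on ?X (mix_im a)"
  proof -
    have "smooth_on ?X (\<lambda>q. (a * slope q * psi_re' a (slope q) + - psi_im' a (slope q)) * inverse (fst (fst q)))"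
      "smooth_on ?X (\<lambda>q. (psi_re' a (slope q) + a * slope q * psi_im' a (slope q)) * inverse (fst (fst q)))"
      by (intro mult minus smooth_on_add[OF X] const smooth_psi_slope)+
    then show "smooth_on ?X (mix_re a)" "smooth_on ?X (mix_im a)"
      by (simp_all add: mix_re_def[abs_def] mix_im_def[abs_def] divide_inverse)
  qed
  have u: "smooth_on ?X (\<lambda>q. snd (snd q))"
    by (intro smooth_on_linear[OF X bounded_linear_snd] smooth_on_id[OF X])
  have "smooth_on ?X (\<lambda>q.
    (((fst c, (fst c * mix_re a q) *\<^sub>R snd (snd q) + - (psi_re a (slope q) *\<^sub>R snd c)),
      (- ((a - 1) * slope q * fst c), snd c)),
     ((0, (fst c * mix_im a q) *\<^sub>R snd (snd q) + - (psi_im a (slope q) *\<^sub>R snd c)),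
      (- fst c, 0))))"
    by (intro smooth_on_Pair[OF X] smooth_on_add[OF X] minus scale mult const mix u smooth_psi_slope)
  then show "smooth_on ?X (\<lambda>q. frame a q c)"
    by (simp add: frame_def)
next
  fix q :: "'n acoord \<times> 'n acoord"
  assume "q \<in> tangent_bundle half_space"
  then have q: "fst (fst q) > 0"
    by (simp add: tangent_half_space)
  show "linear (frame a q)"
    by (rule linearI) (simp_all add: frame_def algebra_simps)
  have comb: "frame a q c + cscale \<i> (frame a q d) =
    (((fst c, psi_im a (slope q) *\<^sub>R snd d - psi_re a (slope q) *\<^sub>R snd c +
      (fst c * mix_re a q - fst d * mix_im a q) *\<^sub>R snd (snd q)),
      (fst d - (a - 1) * slope q * fst c, snd c)),
     ((fst d, - psi_im a (slope q) *\<^sub>R snd c - psi_re a (slope q) *\<^sub>R snd d +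
      (fst c * mix_im a q + fst d * mix_re a q) *\<^sub>R snd (snd q)),
      (- fst c - (a - 1) * slope q * fst d, snd d)))" for c d
    by (simp add: frame_def cscale_ii algebra_simps)
  show "c = 0 \<and> d = 0" if "frame a q c + cscale \<i> (frame a q d) = 0" for c d
    using that unfolding comb by (simp add: prod_eq_iff)
  show "pol a q = {frame a q c + cscale \<i> (frame a q d) | c d. True}"
  proof (intro equalityI subsetI)
    fix z
    assume z: "z \<in> pol a q"
    obtain \<alpha>1 \<beta>1 \<rho>1 \<upsilon>1 \<alpha>2 \<beta>2 \<rho>2 \<upsilon>2 where zeq: "z = (((\<alpha>1, \<beta>1), (\<rho>1, \<upsilon>1)), ((\<alpha>2, \<beta>2), (\<rho>2, \<upsilon>2)))"
      by (metis surj_pair)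
    have "z = frame a q (\<alpha>1, \<upsilon>1) + cscale \<i> (frame a q (\<alpha>2, \<upsilon>2))"
      using z unfolding zeq pol_iff[OF q] comb by simp
    then show "z \<in> {frame a q c + cscale \<i> (frame a q d) | c d. True}"
      by blast
  next
    fix z
    assume "z \<in> {frame a q c + cscale \<i> (frame a q d) | c d. True}"
    then show "z \<in> pol a q"
      by (auto simp: comb pol_iff[OF q])
  qed
qed

lemma polarization_pol: "polarization (tangent_bundle half_space) (pol a :: 'n::finite acoord \<times> 'n acoord \<Rightarrow> _)"
  using complex_subbundle_pol[where 'n = 'n and a = a] involutive_pol[where 'n = 'n and a = a]
  unfolding polarization_def by simp

lemma velocity_has_vector_derivative:
  assumes "smooth_on I \<gamma>" "t \<in> I"
  shows "(\<gamma> has_vector_derivative velocity \<gamma> t) (at t)"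
  unfolding velocity_def vector_derivative_works[symmetric]
  by (rule differentiableI[OF smooth_on_has_derivative[OF assms]])

lemma smooth_on_velocity:
  assumes "open I" "smooth_on I \<gamma>"
  shows "smooth_on I (velocity \<gamma>)"
proof -
  have "velocity \<gamma> t = frechet_derivative \<gamma> (at t) 1" if "t \<in> I" for t
    using fun_cong[OF frechet_derivative_at[OF
          velocity_has_vector_derivative[OF assms(2) that, unfolded has_vector_derivative_def]], of 1]
    by simp
  then show ?thesis
    using smooth_on_cong[OF assms(1), of "velocity \<gamma>" "\<lambda>t. frechet_derivative \<gamma> (at t) 1"]
      smooth_on_frechet_derivative[OF assms(2)] by simp
qed

lemma frechet_derivative_Omega:
  assumes "open I" "smooth_on I \<gamma>" "Re z \<in> I"
  shows "frechet_derivative (Omega \<gamma>) (at z) =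
    (\<lambda>h. (Re h *\<^sub>R velocity \<gamma> (Re z),
      Im h *\<^sub>R velocity \<gamma> (Re z) + (Im z * Re h) *\<^sub>R velocity (velocity \<gamma>) (Re z)))"
proof -
  have Re: "(Re has_derivative Re) (at z)" and Im: "(Im has_derivative Im) (at z)"
    by (rule bounded_linear_imp_has_derivative[OF bounded_linear_Re],
        rule bounded_linear_imp_has_derivative[OF bounded_linear_Im])
  have 1: "((\<lambda>z. \<gamma> (Re z)) has_derivative (\<lambda>h. Re h *\<^sub>R velocity \<gamma> (Re z))) (at z)"
    by (rule has_derivative_compose[OF Re
          velocity_has_vector_derivative[OF assms(2,3), unfolded has_vector_derivative_def]])
  have 2: "((\<lambda>z. velocity \<gamma> (Re z)) has_derivative (\<lambda>h. Re h *\<^sub>R velocity (velocity \<gamma>) (Re z))) (at z)"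
    by (rule has_derivative_compose[OF Re velocity_has_vector_derivative[OF
            smooth_on_velocity[OF assms(1,2)] assms(3), unfolded has_vector_derivative_def]])
  have "(Omega \<gamma> has_derivative (\<lambda>h. (Re h *\<^sub>R velocity \<gamma> (Re z),
      Im z *\<^sub>R Re h *\<^sub>R velocity (velocity \<gamma>) (Re z) + Im h *\<^sub>R velocity \<gamma> (Re z)))) (at z)"
    unfolding Omega_def[abs_def]
    by (rule has_derivative_Pair[OF 1 has_derivative_scaleR[OF Im 2]])
  then show ?thesis
    by (simp add: frechet_derivative_at[symmetric] fun_eq_iff add.commute)
qed

lemma T10_iff: "w \<in> T10 \<longleftrightarrow> snd w = - \<i> * fst w"
proof -
  have "\<i> * fst w = - snd w \<and> \<i> * snd w = fst w \<longleftrightarrow> snd w = - \<i> * fst w"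
  proof
    assume "snd w = - \<i> * fst w"
    then show "\<i> * fst w = - snd w \<and> \<i> * snd w = fst w"
      by (simp add: mult.assoc[symmetric])
  qed simp
  then show ?thesis
    by (simp add: T10_def cmap_def cscale_ii)
qed

text \<open>
  The geodesic equation makes the acceleration a multiple of the velocity \<open>w\<close>. Hence at
  \<open>\<Omega>(t + \<i> s) = (\<gamma>, s w)\<close>, where the slope is \<open>x = s w\<^sub>0 / r\<close>, the image of a \<open>(1, 0)\<close>-vector is a complex
  multiple of \<open>(w, - (\<i> + (a - 1) x) w)\<close>, and such a vector satisfies the equations of the polarization
  by the differential equation for \<open>psi\<close>.
\<close>
lemma Omega_tangent_pol:
  fixes \<gamma> :: "real \<Rightarrow> 'n::finite acoord"
  assumes \<gamma>: "geodesic half_space (connection_of (aff_christoffel a)) I \<gamma>" and z: "Re z \<in> I" and w: "w \<in> T10"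
  shows "cmap (frechet_derivative (Omega \<gamma>) (at z)) w \<in> pol a (Omega \<gamma> z)"
proof -
  have I: "open I" "smooth_on I \<gamma>" "\<gamma> (Re z) \<in> half_space"
    using \<gamma> z by (auto simp: geodesic_def)
  define r w0 wv s c1 c2 where "r = fst (\<gamma> (Re z))" and "w0 = fst (velocity \<gamma> (Re z))"
    and "wv = snd (velocity \<gamma> (Re z))" and "s = Im z" and "c1 = Re (fst w)" and "c2 = Im (fst w)"
  have r: "r > 0"
    using I(3) by (simp add: r_def half_space_def)
  have vel: "velocity \<gamma> (Re z) = (w0, wv)"
    by (simp add: w0_def wv_def)
  have "velocity (velocity \<gamma>) (Re z) = - aff_christoffel a (\<gamma> (Re z)) (w0, wv) (w0, wv)"
    using \<gamma> z unfolding geodesic_def christoffel_connection_of vel[symmetric] eq_neg_iff_add_eq_0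
    by blast
  moreover have "aff_christoffel a (\<gamma> (Re z)) (w0, wv) (w0, wv) = ((a - 1) / (2 * r) * (w0 + w0)) *\<^sub>R (w0, wv)"
    unfolding aff_christoffel_def r_def[symmetric] fst_conv scaleR_left_distrib[symmetric] scaleR_scaleR ..
  moreover have "(a - 1) / (2 * r) * (w0 + w0) = (a - 1) * w0 / r"
    by simp
  ultimately have acc: "velocity (velocity \<gamma>) (Re z) = (- ((a - 1) * w0 / r)) *\<^sub>R (w0, wv)"
    by (simp only: scaleR_minus_left)
  define x where "x = slope (Omega \<gamma> z)"
  have x: "x = s * w0 / r"
    by (simp add: x_def slope_def Omega_def vel r_def s_def)
  have sw: "s * w0 = x * r"
    using r by (simp add: x)
  have snd_w: "Re (snd w) = c2" "Im (snd w) = - c1"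
    using w unfolding T10_iff by (simp_all add: c1_def c2_def)
  define f g f' g' where "f = psi_re a x" and "g = psi_im a x" and "f' = psi_re' a x" and "g' = psi_im' a x"
  note ode = psi_ode_real[of a x, folded f_def g_def f'_def g'_def]
  let ?\<rho>1 = "c2 - (a - 1) * x * c1" and ?\<rho>2 = "- c1 - (a - 1) * x * c2"
  have img: "cmap (frechet_derivative (Omega \<gamma>) (at z)) w =
      (((c1 * w0, c1 *\<^sub>R wv), (?\<rho>1 * w0, ?\<rho>1 *\<^sub>R wv)), ((c2 * w0, c2 *\<^sub>R wv), (?\<rho>2 * w0, ?\<rho>2 *\<^sub>R wv)))"
    unfolding cmap_def frechet_derivative_Omega[OF I(1,2) z] vel acc snd_w
    using r by (simp add: x c1_def[symmetric] c2_def[symmetric] s_def[symmetric] prod_eq_iff vec_eq_iff field_simps)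
  have u: "snd (snd (Omega \<gamma> z)) = s *\<^sub>R wv" "fst (fst (Omega \<gamma> z)) = r"
    by (simp_all add: Omega_def vel s_def r_def)
  have m: "s * (w0 * mix_re a (Omega \<gamma> z)) = x * (a * x * f' - g')"
    "s * (w0 * mix_im a (Omega \<gamma> z)) = x * (f' + a * x * g')"
    unfolding mix_re_def mix_im_def x_def[symmetric] f'_def[symmetric] g'_def[symmetric] u mult.assoc[symmetric] sw
    using r by simp_all
  have c: "c1 = g * ?\<rho>2 - f * ?\<rho>1 + (c1 * (x * (a * x * f' - g')) - c2 * (x * (f' + a * x * g')))"
    "c2 = - g * ?\<rho>1 - f * ?\<rho>2 + (c1 * (x * (f' + a * x * g')) + c2 * (x * (a * x * f' - g')))"
    using ode by algebra+
  have c': "c1 = g * ?\<rho>2 - f * ?\<rho>1 + (c1 * w0 * mix_re a (Omega \<gamma> z) - c2 * w0 * mix_im a (Omega \<gamma> z)) * s"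
    "c2 = - g * ?\<rho>1 - f * ?\<rho>2 + (c1 * w0 * mix_im a (Omega \<gamma> z) + c2 * w0 * mix_re a (Omega \<gamma> z)) * s"
    using c m by algebra+
  have "c1 *\<^sub>R wv = (g * ?\<rho>2 - f * ?\<rho>1 +
      (c1 * w0 * mix_re a (Omega \<gamma> z) - c2 * w0 * mix_im a (Omega \<gamma> z)) * s) *\<^sub>R wv"
    using c'(1) by presburger
  also have "\<dots> = g *\<^sub>R (?\<rho>2 *\<^sub>R wv) - f *\<^sub>R (?\<rho>1 *\<^sub>R wv) +
      (c1 * w0 * mix_re a (Omega \<gamma> z) - c2 * w0 * mix_im a (Omega \<gamma> z)) *\<^sub>R s *\<^sub>R wv"
    by (simp only: scaleR_scaleR) (simp only: scaleR_add_left scaleR_diff_left)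
  finally have v1: "c1 *\<^sub>R wv = \<dots>" .
  have "c2 *\<^sub>R wv = (- g * ?\<rho>1 - f * ?\<rho>2 +
      (c1 * w0 * mix_im a (Omega \<gamma> z) + c2 * w0 * mix_re a (Omega \<gamma> z)) * s) *\<^sub>R wv"
    using c'(2) by presburger
  also have "\<dots> = - g *\<^sub>R (?\<rho>1 *\<^sub>R wv) - f *\<^sub>R (?\<rho>2 *\<^sub>R wv) +
      (c1 * w0 * mix_im a (Omega \<gamma> z) + c2 * w0 * mix_re a (Omega \<gamma> z)) *\<^sub>R s *\<^sub>R wv"
    by (simp only: scaleR_scaleR) (simp only: scaleR_add_left scaleR_diff_left)
  finally have v2: "c2 *\<^sub>R wv = \<dots>" .
  have "fst (fst (Omega \<gamma> z)) > 0"
    using r u by simp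
  then show ?thesis
    unfolding img pol_iff[OF \<open>fst (fst (Omega \<gamma> z)) > 0\<close>]
      x_def[symmetric] f_def[symmetric] g_def[symmetric] u(1)
    by (intro conjI v1 v2) (simp_all add: algebra_simps)
qed

lemma P_complete_aff: "P_complete half_space (connection_of (aff_christoffel a :: 'n::finite acoord \<Rightarrow> _))"
proof -
  have "ac_polarization half_space (connection_of (aff_christoffel a :: 'n acoord \<Rightarrow> _)) (pol a)"
    unfolding ac_polarization_def maximal_geodesic_def geodesic_from_def complex_strip_def mem_Collect_eq
  proof (intro conjI polarization_pol ballI allI impI image_subsetI; elim conjE)
    fix I and \<gamma> :: "real \<Rightarrow> 'n acoord" and z w
    assume "geodesic half_space (connection_of (aff_christoffel a)) I \<gamma>" "w \<in> T10" "z \<in> {z. Re z \<in> I}"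
    then show "cmap (frechet_derivative (Omega \<gamma>) (at z)) w \<in> pol a (Omega \<gamma> z)"
      by (intro Omega_tangent_pol) simp_all
  qed
  then show ?thesis
    unfolding P_complete_def by blast
qed

section \<open>The classification\<close>
theorem theorem9p1:
  shows "(\<forall>D :: 'n::finite acoord connection.
      koszul_connection half_space D \<and> left_invariant D \<and> torsion_free half_space D \<longrightarrow>
        (biinvariant D \<longleftrightarrow> (\<exists>a. satisfies_formula a D)))
    \<and> (\<forall>a x0 y0. \<forall>xv\<in>V_sub :: 'n amat set. \<forall>yv\<in>V_sub.
        form1 a x0 xv y0 yv = form2 a x0 xv y0 yv)
    \<and> (\<forall>a. \<exists>D :: 'n acoord connection.
        koszul_connection half_space D \<and> satisfies_formula a D \<and>
        (\<forall>D' X Y. koszul_connection half_space D' \<longrightarrow> satisfies_formula a D' \<longrightarrow>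
           smooth_on half_space X \<longrightarrow> smooth_on half_space Y \<longrightarrow>
           (\<forall>p\<in>half_space. D' X Y p = D X Y p)) \<and>
        torsion_free half_space D \<and> biinvariant D \<and> P_complete half_space D)"
proof (intro conjI allI impI ballI)
  fix D :: "'n acoord connection"
  assume D: "koszul_connection half_space D \<and> left_invariant D \<and> torsion_free half_space D"
  then have K: "koszul_connection half_space D"
    by simp
  show "biinvariant D \<longleftrightarrow> (\<exists>a. satisfies_formula a D)"
    unfolding satisfies_formula_iff_christoffel[OF K]
    using aff_christoffel_if_biinvariant[OF K] biinvariant_if_aff_christoffel[OF K] D by metis
next
  show "form1 a x0 xv y0 yv = form2 a x0 xv y0 yv" if "xv \<in> V_sub" "yv \<in> V_sub"
    for a x0 y0 and xv yv :: "'n amat"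
    using that by (rule form1_eq_form2)
next
  fix a
  let ?D = "connection_of (aff_christoffel a) :: 'n acoord connection"
  note K = koszul_aff_christoffel[of a, where 'n = 'n]
  have \<Gamma>: "christoffel ?D = aff_christoffel a"
    by (rule christoffel_connection_of)
  have "D' X Y p = ?D X Y p"
    if "koszul_connection half_space D'" "satisfies_formula a D'" "smooth_on half_space X"
      "smooth_on half_space Y" "p \<in> half_space" for D' X Y p
  proof -
    have "christoffel D' p (X p) (Y p) = aff_christoffel a p (X p) (Y p)"
      using that(2,5) unfolding satisfies_formula_iff_christoffel[OF that(1)] by blast
    then show ?thesis
      using koszul_eq_christoffel[OF that(1) open_half_space that(5,3,4)]
      by (simp add: connection_of_def)
  qed
  moreover have "satisfies_formula a ?D"
    by (simp add: satisfies_formula_iff_christoffel[OF K] \<Gamma>)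
  moreover have "torsion_free half_space ?D"
    by (simp add: torsion_free_iff_christoffel[OF K open_half_space] \<Gamma> aff_christoffel_def add.commute)
  moreover have "biinvariant ?D"
    by (rule biinvariant_if_aff_christoffel[OF K]) (simp add: \<Gamma>)
  ultimately show "\<exists>D :: 'n acoord connection.
        koszul_connection half_space D \<and> satisfies_formula a D \<and>
        (\<forall>D' X Y. koszul_connection half_space D' \<longrightarrow> satisfies_formula a D' \<longrightarrow>
           smooth_on half_space X \<longrightarrow> smooth_on half_space Y \<longrightarrow>
           (\<forall>p\<in>half_space. D' X Y p = D X Y p)) \<and>
        torsion_free half_space D \<and> biinvariant D \<and> P_complete half_space D"
    using K P_complete_aff by (intro exI[of _ ?D]) blast
qed

end
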